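(* Let $\rho\in[-1,1]$, and let $(X_i,Y_i)_{i\ge 1}$ be i.i.d. pairs with $X_i\sim\mathcal N(0,1)$ and $Y_i=\rho X_i+\sqrt{1-\rho^2}\,Z_i$, where $Z_i\sim\mathcal N(0,1)$ is independent of $X_i$. For an integer $k\ge 1$ let $J=\operatorname{argmax}_{i\in\{1,\dots,2^k\}}X_i$ (so that $J$ can be described with exactly $k$ bits) and let $$\hat\rho_{\max}=\frac{Y_J}{\mathbb E X_J}.$$ Then $\hat\rho_{\max}$ is unbiased, i.e. $\mathbb E\hat\rho_{\max}=\rho$, and $$\operatorname{Var}\hat\rho_{\max}=\frac1k\left(\frac{1-\rho^2}{2\ln 2}+o(1)\right),\qquad k\to\infty.$$ Furthermore, for $|\rho|<1$, $\hat\rho_{\max}$ is asymptotically efficient given $(X_J,Y_J)$.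
   Context: Setting: Alice observes $(X_i)$ and sends $k$ bits (the index $J$) to Bob, who observes $(Y_i)$ and wants to estimate the unknown correlation $\rho$. Fisher information: for a statistic $T$ with density $f(t\mid\rho)$, $\mathrm I_T(\rho)=\mathbb E\big[(\partial_\rho\log f(T\mid\rho))^2\big]$ with natural logarithm. An estimator $\hat\rho$ (depending on $k$) is called asymptotically efficient given $T$ (also depending on $k$) if $\mathbb E\hat\rho\to\rho$ and $\mathrm I_T(\rho)\cdot\operatorname{Var}\hat\rho\to1$ as $k\to\infty$. The $o(1)$ term is for fixed $\rho$ as $k\to\infty$. *)

theory Defs
  imports "HOL-Probability.Probability"
begin

text \<open>
  The law of the observations: the pairs are independent and each one satisfies
  \<open>Y\<^sub>i = \<rho> X\<^sub>i + sqrt (1 - \<rho>\<^sup>2) Z\<^sub>i\<close> with \<open>X\<^sub>i, Z\<^sub>i\<close> independent standard normal variables.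
  All pairs then have the same law, so that they are i.i.d.; independence of the
  \<open>Z\<^sub>i\<close> across \<open>i\<close> is not assumed separately.
\<close>

definition gaussian_pairs ::
  "'w measure \<Rightarrow> real \<Rightarrow> (nat \<Rightarrow> 'w \<Rightarrow> real) \<Rightarrow> (nat \<Rightarrow> 'w \<Rightarrow> real) \<Rightarrow> bool" where
  "gaussian_pairs M \<rho> X Y \<longleftrightarrow>
     prob_space M \<and>
     prob_space.indep_vars M (\<lambda>_. borel :: (real \<times> real) measure) (\<lambda>i \<omega>. (X i \<omega>, Y i \<omega>)) {1..} \<and>
     (\<forall>i\<ge>1. distributed M lborel (X i) std_normal_density \<and>
        (\<exists>Z. distributed M lborel Z std_normal_density \<and>
             prob_space.indep_var M borel (X i) borel Z \<and>
             (AE \<omega> in M. Y i \<omega> = \<rho> * X i \<omega> + sqrt (1 - \<rho>\<^sup>2) * Z \<omega>)))"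

text \<open>Ties, which have probability zero, are broken arbitrarily.\<close>

definition max_index :: "(nat \<Rightarrow> 'w \<Rightarrow> real) \<Rightarrow> nat \<Rightarrow> 'w \<Rightarrow> nat" where
  "max_index X k \<omega> = arg_max_on (\<lambda>i. X i \<omega>) {1..2 ^ k}"

lemma is_arg_max_max_index:
  "is_arg_max (\<lambda>i. X i \<omega>) (\<lambda>i. i \<in> {1..2 ^ k}) (max_index X k \<omega>)"
proof -
  have "finite ((\<lambda>i. X i \<omega>) ` {1..2 ^ k})" "(\<lambda>i. X i \<omega>) ` {1..2 ^ k} \<noteq> {}"
    by auto
  then obtain i where "i \<in> {1..2 ^ k}" "X i \<omega> = Max ((\<lambda>i. X i \<omega>) ` {1..2 ^ k})"
    by (metis (no_types, lifting) Max_in imageE)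
  then have "is_arg_max (\<lambda>i. X i \<omega>) (\<lambda>i. i \<in> {1..2 ^ k}) i"
    by (auto simp: is_arg_max_linorder)
  then show ?thesis
    unfolding max_index_def arg_max_on_def arg_max_def by (rule someI)
qed

lemma max_index_in: "max_index X k \<omega> \<in> {1..2 ^ k}"
  using is_arg_max_max_index[of X \<omega> k] by (simp add: is_arg_max_def)

definition max_statistic ::
  "(nat \<Rightarrow> 'w \<Rightarrow> real) \<Rightarrow> (nat \<Rightarrow> 'w \<Rightarrow> real) \<Rightarrow> nat \<Rightarrow> 'w \<Rightarrow> real \<times> real" where
  "max_statistic X Y k \<omega> = (X (max_index X k \<omega>) \<omega>, Y (max_index X k \<omega>) \<omega>)"

definition rho_max ::
  "'w measure \<Rightarrow> (nat \<Rightarrow> 'w \<Rightarrow> real) \<Rightarrow> (nat \<Rightarrow> 'w \<Rightarrow> real) \<Rightarrow> nat \<Rightarrow> 'w \<Rightarrow> real" where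
  "rho_max M X Y k \<omega> =
     Y (max_index X k \<omega>) \<omega> / prob_space.expectation M (\<lambda>\<omega>. X (max_index X k \<omega>) \<omega>)"

text \<open>
  A statistical model is a family of measures \<open>P r\<close> indexed by the parameter \<open>r \<in> \<Theta>\<close>, with \<open>\<Theta>\<close> open.
  A density is determined by the law only up to null sets, separately for each \<open>r\<close>, which
  leaves its derivative in \<open>r\<close> undetermined. We therefore require versions that are
  differentiable in \<open>r\<close>; by the uniqueness lemma below the Fisher information
  does not depend on which of them is used.
\<close>

definition smooth_density_family ::
  "real set \<Rightarrow> (real \<Rightarrow> 'w measure) \<Rightarrow> ('w \<Rightarrow> 't::euclidean_space) \<Rightarrow> (real \<Rightarrow> 't \<Rightarrow> real) \<Rightarrow> bool" where
  "smooth_density_family \<Theta> P T f \<longleftrightarrow>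
     (\<forall>r\<in>\<Theta>. distributed (P r) lborel T (f r) \<and> (\<forall>t. 0 \<le> f r t)) \<and>
     (\<forall>t. (\<lambda>r. f r t) differentiable_on \<Theta>)"

definition has_fisher_information ::
  "real set \<Rightarrow> (real \<Rightarrow> 'w measure) \<Rightarrow> ('w \<Rightarrow> 't::euclidean_space) \<Rightarrow> real \<Rightarrow> real \<Rightarrow> bool" where
  "has_fisher_information \<Theta> P T \<rho> I \<longleftrightarrow>
     (\<exists>f. smooth_density_family \<Theta> P T f \<and>
          integrable (P \<rho>) (\<lambda>\<omega>. (deriv (\<lambda>r. ln (f r (T \<omega>))) \<rho>)\<^sup>2) \<and>
          I = prob_space.expectation (P \<rho>) (\<lambda>\<omega>. (deriv (\<lambda>r. ln (f r (T \<omega>))) \<rho>)\<^sup>2))"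

lemma smooth_density_family_AE_eq:
  fixes T :: "'w \<Rightarrow> 't::euclidean_space"
  assumes f: "smooth_density_family \<Theta> P T f" and g: "smooth_density_family \<Theta> P T g"
    and prob: "\<And>r. r \<in> \<Theta> \<Longrightarrow> prob_space (P r)" and "open \<Theta>"
  shows "AE t in lborel. \<forall>r\<in>\<Theta>. f r t = g r t"
proof -
  have "AE t in lborel. f r t = g r t" if "r \<in> \<Theta>" for r
  proof -
    have df: "distributed (P r) lborel T (f r)" and dg: "distributed (P r) lborel T (g r)"
      and nn: "\<And>t. 0 \<le> f r t" "\<And>t. 0 \<le> g r t"
      using f g that by (auto simp: smooth_density_family_def)
    have "prob_space (distr (P r) lborel T)"
      using df prob[OF that] by (intro prob_space.prob_space_distr) (auto simp: distributed_def)
    then have "sigma_finite_measure (density lborel (f r))"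
      using df by (auto simp: distributed_def intro: prob_space_imp_sigma_finite)
    then have "AE t in lborel. ennreal (f r t) = ennreal (g r t)"
      using df dg sigma_finite_density_unique[of "\<lambda>t. ennreal (f r t)" lborel "\<lambda>t. ennreal (g r t)"]
      by (auto simp: distributed_def)
    then show ?thesis
      by eventually_elim (use nn in auto)
  qed
  then have "AE t in lborel. \<forall>r\<in>\<Theta> \<inter> \<rat>. f r t = g r t"
    by (intro AE_ball_countable') (auto intro: countable_subset[OF _ countable_rat])
  then show ?thesis
  proof eventually_elim
    case (elim t)
    have "continuous_on \<Theta> (\<lambda>r. f r t - g r t)"
      using f g by (intro continuous_intros differentiable_imp_continuous_on)
        (auto simp: smooth_density_family_def)
    then have "open (\<Theta> \<inter> (\<lambda>r. f r t - g r t) -` (- {0}))"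
      using \<open>open \<Theta>\<close> by (intro continuous_open_preimage) auto
    then have "\<Theta> \<inter> (\<lambda>r. f r t - g r t) -` (- {0}) = {}"
    proof (rule contrapos_pp)
      assume "\<Theta> \<inter> (\<lambda>r. f r t - g r t) -` (- {0}) \<noteq> {}"
      moreover have "\<rat> \<inter> (\<Theta> \<inter> (\<lambda>r. f r t - g r t) -` (- {0})) = {}"
        using elim by auto
      ultimately show "\<not> open (\<Theta> \<inter> (\<lambda>r. f r t - g r t) -` (- {0}))"
        by (metis Int_UNIV_right Int_commute Rats_closure_real open_Int_closure_eq_empty)
    qed
    then show ?case by auto
  qed
qed

lemma has_fisher_information_unique:
  fixes T :: "'w \<Rightarrow> 't::euclidean_space"
  assumes I: "has_fisher_information \<Theta> P T \<rho> I" and I': "has_fisher_information \<Theta> P T \<rho> I'"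
    and prob: "\<And>r. r \<in> \<Theta> \<Longrightarrow> prob_space (P r)" and "open \<Theta>" "\<rho> \<in> \<Theta>"
  shows "I = I'"
proof -
  obtain f where f: "smooth_density_family \<Theta> P T f"
    "integrable (P \<rho>) (\<lambda>\<omega>. (deriv (\<lambda>r. ln (f r (T \<omega>))) \<rho>)\<^sup>2)"
    "I = prob_space.expectation (P \<rho>) (\<lambda>\<omega>. (deriv (\<lambda>r. ln (f r (T \<omega>))) \<rho>)\<^sup>2)"
    using I by (auto simp: has_fisher_information_def)
  obtain g where g: "smooth_density_family \<Theta> P T g"
    "integrable (P \<rho>) (\<lambda>\<omega>. (deriv (\<lambda>r. ln (g r (T \<omega>))) \<rho>)\<^sup>2)"
    "I' = prob_space.expectation (P \<rho>) (\<lambda>\<omega>. (deriv (\<lambda>r. ln (g r (T \<omega>))) \<rho>)\<^sup>2)"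
    using I' by (auto simp: has_fisher_information_def)
  have d: "distributed (P \<rho>) lborel T (f \<rho>)"
    using f(1) \<open>\<rho> \<in> \<Theta>\<close> by (auto simp: smooth_density_family_def)
  have "AE t in lborel. \<forall>r\<in>\<Theta>. f r t = g r t"
    using smooth_density_family_AE_eq[OF f(1) g(1) prob \<open>open \<Theta>\<close>] .
  then have "AE t in density lborel (f \<rho>). \<forall>r\<in>\<Theta>. f r t = g r t"
    using d by (subst AE_density) (auto simp: distributed_def elim: eventually_mono)
  then have "AE t in distr (P \<rho>) lborel T. \<forall>r\<in>\<Theta>. f r t = g r t"
    using d unfolding distributed_def by metis
  then have "AE \<omega> in P \<rho>. \<forall>r\<in>\<Theta>. f r (T \<omega>) = g r (T \<omega>)"
    using d by (intro AE_distrD[of T "P \<rho>" lborel]) (auto simp: distributed_def)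
  then have "AE \<omega> in P \<rho>. (deriv (\<lambda>r. ln (f r (T \<omega>))) \<rho>)\<^sup>2 = (deriv (\<lambda>r. ln (g r (T \<omega>))) \<rho>)\<^sup>2"
  proof eventually_elim
    case (elim \<omega>)
    have "eventually (\<lambda>r. r \<in> \<Theta>) (nhds \<rho>)"
      using \<open>open \<Theta>\<close> \<open>\<rho> \<in> \<Theta>\<close> by (rule eventually_nhds_in_open)
    then have "eventually (\<lambda>r. ln (f r (T \<omega>)) = ln (g r (T \<omega>))) (nhds \<rho>)"
      by eventually_elim (use elim in auto)
    then show ?case by (metis deriv_cong_ev)
  qed
  then show ?thesis
    unfolding f(3) g(3) using f(2) g(2) by (intro integral_cong_AE) auto
qed

text \<open>Asymptotic efficiency at \<open>\<rho>\<close> of estimators \<open>E k\<close> given statistics \<open>T k\<close>, for \<open>k \<ge> 1\<close>.\<close>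

definition asymptotically_efficient ::
  "real set \<Rightarrow> (real \<Rightarrow> 'w measure) \<Rightarrow> (nat \<Rightarrow> 'w \<Rightarrow> 't::euclidean_space) \<Rightarrow>
     (nat \<Rightarrow> 'w \<Rightarrow> real) \<Rightarrow> real \<Rightarrow> bool" where
  "asymptotically_efficient \<Theta> P T E \<rho> \<longleftrightarrow>
     (\<lambda>k. prob_space.expectation (P \<rho>) (E k)) \<longlonglongrightarrow> \<rho> \<and>
     (\<exists>I. (\<forall>k\<ge>1. has_fisher_information \<Theta> P (T k) \<rho> (I k)) \<and>
          (\<lambda>k. I k * prob_space.variance (P \<rho>) (E k)) \<longlonglongrightarrow> 1)"

end

theory Submission
  imports Defs "HOL-Real_Asymp.Real_Asymp"
begin

text \<open>
  Put \<open>n = 2\<^sup>k\<close>, \<open>a = sqrt (2 ln n)\<close>, and let \<open>m\<close> and \<open>v\<close> be the mean and the variance of \<open>X\<^sub>J\<close>.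
  Since \<open>J\<close> depends on the \<open>X\<^sub>i\<close> only, the pair \<open>(X\<^sub>J, Y\<^sub>J)\<close> has the law of \<open>(x, \<rho> x + sqrt (1 - \<rho>\<^sup>2) z)\<close>
  where \<open>x\<close> is distributed as the maximum of \<open>n\<close> standard normal variables and \<open>z\<close> is an independent
  standard normal variable. So the estimator is unbiased with variance \<open>(\<rho>\<^sup>2 v + 1 - \<rho>\<^sup>2) / m\<^sup>2\<close>, and
  the Fisher information is \<open>2 \<rho>\<^sup>2 / (1 - \<rho>\<^sup>2)\<^sup>2 + (v + m\<^sup>2) / (1 - \<rho>\<^sup>2)\<close>. Both limits then follow from
  the single fact that the maximum converges to \<open>a\<close> in mean square, which gives \<open>v \<rightarrow> 0\<close> and
  \<open>m - a \<rightarrow> 0\<close>.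
\<close>

section \<open>The law of a sample at the index of its largest score\<close>

text \<open>No conditioning on \<open>J\<close> occurs. Splitting by the value of \<open>J\<close>
  and using Fubini gives the selected pair the density \<open>n * F(x)^(n-1)\<close> with respect to
  the law of one pair, \<open>F\<close> being the distribution function of the score. This weight
  involves the first coordinate only, so the noise coordinate stays standard normal and independent.

  Sharp extreme value asymptotics are avoided. Left of \<open>a - \<delta>\<close> the power
  \<open>F^(n-1)\<close> is tiny: \<open>n\<close> times the normal tail beyond
  \<open>a - \<delta>\<close> still grows exponentially in \<open>a\<close>, so the power decays
  doubly exponentially and beats \<open>n = exp (a^2 / 2)\<close>. Between
  \<open>a - \<delta>\<close> and \<open>a\<close> the square is at most \<open>\<delta>^2\<close>,
  and right of \<open>a\<close> the comparison with \<open>n\<close> normal densities costs only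
  \<open>2 / a^2\<close>.

  Efficiency comes from \<open>m^2\<close> growing like \<open>2 k ln 2\<close>: in the information
  the bounded term \<open>2 \<rho>^2 / (1 - \<rho>^2)^2\<close> becomes negligible against
  \<open>m^2 / (1 - \<rho>^2)\<close>, whose reciprocal is the leading term of the variance. For
  correlation 1 or -1 the pair lies on a line and has no density in the plane.\<close>

lemma (in prob_space) emeasure_indep_vars_comparison:
  assumes indep: "indep_vars (\<lambda>_. N) W I" and I: "finite I" "i \<in> I"
    and [measurable]: "A \<in> sets N" "S \<in> sets (N \<Otimes>\<^sub>M N)"
  shows "emeasure M {\<omega>\<in>space M. W i \<omega> \<in> A \<and> (\<forall>j\<in>I - {i}. (W i \<omega>, W j \<omega>) \<in> S)} =
    (\<integral>\<^sup>+w. indicator A w * (\<Prod>j\<in>I - {i}. emeasure (distr M N (W j)) (Pair w -` S)) \<partial>distr M N (W i))"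
proof -
  define K where "K = I - {i}"
  define V where "V = (\<lambda>\<omega>. restrict (\<lambda>j. W j \<omega>) K)"
  \<comment> \<open>\<open>W i\<close> is wrapped as a one-point family because
    \<open>indep_var_restrict\<close> speaks of restrictions to disjoint index sets.\<close>
  define R where "R = (\<lambda>\<omega>. restrict (\<lambda>j. W j \<omega>) {i})"
  define H where "H = {p \<in> space (PiM {i} (\<lambda>_. N) \<Otimes>\<^sub>M PiM K (\<lambda>_. N)).
    fst p i \<in> A \<and> (\<forall>j\<in>K. (fst p i, snd p j) \<in> S)}"
  have "finite K" "K \<subseteq> I" "i \<notin> K"
    using I by (auto simp: K_def)
  have rv: "W j \<in> measurable M N" if "j \<in> I" for j
    using indep that by (auto simp: indep_vars_def)
  have [measurable]: "W i \<in> measurable M N"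
    using I rv by auto
  have W[measurable]: "j \<in> K \<Longrightarrow> W j \<in> measurable M N" for j
    using \<open>K \<subseteq> I\<close> rv by auto
  have V[measurable]: "V \<in> measurable M (PiM K (\<lambda>_. N))"
    unfolding V_def by measurable
  have R[measurable]: "R \<in> measurable M (PiM {i} (\<lambda>_. N))"
    unfolding R_def using I rv by (intro measurable_restrict) auto
  have H[measurable]: "H \<in> sets (PiM {i} (\<lambda>_. N) \<Otimes>\<^sub>M PiM K (\<lambda>_. N))"
    unfolding H_def using \<open>finite K\<close> by measurable
  \<comment> \<open>Independence of \<open>W i\<close> from the whole block of the others makes
    their joint law a product, so Fubini allows \<open>W i\<close> to be frozen at a value
    \<open>w\<close>; the comparisons with the other samples then factor.\<close>
  have "indep_var (PiM {i} (\<lambda>_. N)) R (PiM K (\<lambda>_. N)) V"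
    unfolding R_def V_def using I \<open>K \<subseteq> I\<close> \<open>i \<notin> K\<close> by (intro indep_var_restrict[OF indep]) auto
  then have joint: "distr M (PiM {i} (\<lambda>_. N) \<Otimes>\<^sub>M PiM K (\<lambda>_. N)) (\<lambda>\<omega>. (R \<omega>, V \<omega>)) =
      distr M (PiM {i} (\<lambda>_. N)) R \<Otimes>\<^sub>M distr M (PiM K (\<lambda>_. N)) V"
    by (simp add: indep_var_distribution_eq)
  interpret D: prob_space "distr M (PiM K (\<lambda>_. N)) V"
    by (rule prob_space_distr) simp
  have "{\<omega>\<in>space M. W i \<omega> \<in> A \<and> (\<forall>j\<in>I - {i}. (W i \<omega>, W j \<omega>) \<in> S)} =
      (\<lambda>\<omega>. (R \<omega>, V \<omega>)) -` H \<inter> space M"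
    using measurable_space[OF R] measurable_space[OF V]
    by (auto simp: H_def space_pair_measure) (auto simp: R_def V_def K_def)
  then have "emeasure M {\<omega>\<in>space M. W i \<omega> \<in> A \<and> (\<forall>j\<in>I - {i}. (W i \<omega>, W j \<omega>) \<in> S)} =
      emeasure (distr M (PiM {i} (\<lambda>_. N)) R \<Otimes>\<^sub>M distr M (PiM K (\<lambda>_. N)) V) H"
    by (simp add: joint[symmetric] emeasure_distr)
  also have "\<dots> = (\<integral>\<^sup>+r. emeasure (distr M (PiM K (\<lambda>_. N)) V) (Pair r -` H) \<partial>distr M (PiM {i} (\<lambda>_. N)) R)"
    by (intro D.emeasure_pair_measure_alt) simp
  also have "\<dots> = (\<integral>\<^sup>+\<omega>. emeasure (distr M (PiM K (\<lambda>_. N)) V) (Pair (R \<omega>) -` H) \<partial>M)"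
    by (intro nn_integral_distr R) (simp add: D.measurable_emeasure_Pair)
  also have "\<dots> = (\<integral>\<^sup>+\<omega>. indicator A (W i \<omega>) * (\<Prod>j\<in>K. emeasure (distr M N (W j)) (Pair (W i \<omega>) -` S)) \<partial>M)"
  proof (intro nn_integral_cong)
    fix \<omega>' assume \<omega>': "\<omega>' \<in> space M"
    define r where "r = R \<omega>'"
    define w where "w = W i \<omega>'"
    have r: "r \<in> space (PiM {i} (\<lambda>_. N))" "r i = w"
      using \<omega>' measurable_space[OF R] by (auto simp: r_def w_def R_def)
    have [measurable]: "Pair w -` S \<in> sets N"
      by (rule sets_Pair1[of S N N]) simp
    have "emeasure (distr M (PiM K (\<lambda>_. N)) V) (Pair r -` H) = emeasure M (V -` (Pair r -` H) \<inter> space M)"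
      using sets_Pair1[OF H] by (intro emeasure_distr V) auto
    also have "V -` (Pair r -` H) \<inter> space M =
        (if w \<in> A then {\<omega>\<in>space M. \<forall>j\<in>K. W j \<omega> \<in> Pair w -` S} else {})"
      using r measurable_space[OF V] by (auto simp: H_def space_pair_measure) (auto simp: V_def)
    also have "emeasure M \<dots> = indicator A w * emeasure M {\<omega>\<in>space M. \<forall>j\<in>K. W j \<omega> \<in> Pair w -` S}"
      by (auto simp: indicator_def)
    also have "emeasure M {\<omega>\<in>space M. \<forall>j\<in>K. W j \<omega> \<in> Pair w -` S} =
        (\<Prod>j\<in>K. emeasure (distr M N (W j)) (Pair w -` S))"
    \<comment> \<open>A sample of size one has to be treated apart, since \<open>indep_varsD\<close>
      is stated for nonempty index sets.\<close>
    proof (cases "K = {}")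
      case True then show ?thesis by (simp add: emeasure_space_1)
    next
      case False
      have "{\<omega>\<in>space M. \<forall>j\<in>K. W j \<omega> \<in> Pair w -` S} = (\<Inter>j\<in>K. W j -` (Pair w -` S) \<inter> space M)"
        using False by auto
      then have "prob {\<omega>\<in>space M. \<forall>j\<in>K. W j \<omega> \<in> Pair w -` S} =
          (\<Prod>j\<in>K. prob (W j -` (Pair w -` S) \<inter> space M))"
        using False \<open>finite K\<close> \<open>K \<subseteq> I\<close> indep_varsD[OF indep, of K "\<lambda>_. Pair w -` S"] by simp
      then have "emeasure M {\<omega>\<in>space M. \<forall>j\<in>K. W j \<omega> \<in> Pair w -` S} =
          (\<Prod>j\<in>K. emeasure M (W j -` (Pair w -` S) \<inter> space M))"
        by (simp add: emeasure_eq_measure prod_ennreal)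
      also have "\<dots> = (\<Prod>j\<in>K. emeasure (distr M N (W j)) (Pair w -` S))"
        by (intro prod.cong) (auto simp: emeasure_distr)
      finally show ?thesis .
    qed
    finally show "emeasure (distr M (PiM K (\<lambda>_. N)) V) (Pair (R \<omega>') -` H) =
      indicator A (W i \<omega>') * (\<Prod>j\<in>K. emeasure (distr M N (W j)) (Pair (W i \<omega>') -` S))"
      by (simp add: r_def w_def)
  qed
  also have "\<dots> = (\<integral>\<^sup>+w. indicator A w * (\<Prod>j\<in>K. emeasure (distr M N (W j)) (Pair w -` S)) \<partial>distr M N (W i))"
  proof (intro nn_integral_distr[symmetric] borel_measurable_times_ennreal borel_measurable_prod_ennreal)
    fix j assume "j \<in> K"
    then interpret Wj: prob_space "distr M N (W j)"
      by (intro prob_space_distr W)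
    show "(\<lambda>w. emeasure (distr M N (W j)) (Pair w -` S)) \<in> borel_measurable (distr M N (W i))"
      by (simp add: Wj.measurable_emeasure_Pair)
  qed auto
  finally show ?thesis by (simp add: K_def)
qed

text \<open>The event that \<open>J\<close> picks \<open>i\<close> lies between the events that \<open>W\<^sub>i\<close> beats all the others
  strictly and weakly; these have the same probability when the score has no atoms, so that
  the tie-breaking rule does not matter.\<close>

lemma (in prob_space) emeasure_argmax:
  fixes h :: "'b \<Rightarrow> real"
  assumes indep: "indep_vars (\<lambda>_. N) W I" and I: "finite I"
    and law: "\<And>i. i \<in> I \<Longrightarrow> distr M N (W i) = \<mu>"
    and h[measurable]: "h \<in> borel_measurable N"
    and atomless: "\<And>x. emeasure \<mu> {w\<in>space N. h w = x} = 0"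
    and J[measurable]: "J \<in> measurable M (count_space I)"
    and max: "\<And>\<omega> i. \<omega> \<in> space M \<Longrightarrow> i \<in> I \<Longrightarrow> h (W i \<omega>) \<le> h (W (J \<omega>) \<omega>)"
    and A[measurable]: "A \<in> sets N"
  shows "emeasure M {\<omega>\<in>space M. W (J \<omega>) \<omega> \<in> A} =
    (\<integral>\<^sup>+w. of_nat (card I) * emeasure \<mu> {v\<in>space N. h v \<le> h w} ^ (card I - 1) * indicator A w \<partial>\<mu>)"
proof -
  define q where "q w = emeasure \<mu> {v\<in>space N. h v \<le> h w} ^ (card I - 1)" for w
  have rv[measurable]: "i \<in> I \<Longrightarrow> W i \<in> measurable M N" for i
    using indep by (auto simp: indep_vars_def)
  have strict: "emeasure \<mu> {v\<in>space N. h v < x} = emeasure \<mu> {v\<in>space N. h v \<le> x}" if "i \<in> I" for x i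
  proof -
    have [measurable_cong]: "sets \<mu> = sets N"
      using law[OF that] by auto
    have "AE v in \<mu>. h v \<noteq> x"
      using atomless[of x] law[OF that] by (intro AE_I[of _ _ "{w\<in>space N. h w = x}"]) auto
    then show ?thesis
      by (intro emeasure_eq_AE) auto
  qed
  have "emeasure M {\<omega>\<in>space M. J \<omega> = i \<and> W i \<omega> \<in> A} = (\<integral>\<^sup>+w. indicator A w * q w \<partial>\<mu>)"
    if i: "i \<in> I" for i
  proof (rule antisym)
    let ?le = "{p\<in>space (N \<Otimes>\<^sub>M N). h (snd p) \<le> h (fst p)}"
    let ?lt = "{p\<in>space (N \<Otimes>\<^sub>M N). h (snd p) < h (fst p)}"
    have spN: "W j \<omega> \<in> space N" if "\<omega> \<in> space M" "j \<in> I" for j \<omega>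
      using rv[OF that(2)] that(1) by (auto simp: measurable_def)
    have sec: "(\<integral>\<^sup>+w. indicator A w * (\<Prod>j\<in>I - {i}. emeasure (distr M N (W j)) (Pair w -` S)) \<partial>distr M N (W i)) =
       (\<integral>\<^sup>+w. indicator A w * q w \<partial>\<mu>)" if "S = ?le \<or> S = ?lt" for S
    proof -
      have "Pair w -` ?le = {v\<in>space N. h v \<le> h w}" "Pair w -` ?lt = {v\<in>space N. h v < h w}"
        if "w \<in> space N" for w
        using that by (auto simp: space_pair_measure)
      then have "emeasure \<mu> (Pair w -` S) = emeasure \<mu> {v\<in>space N. h v \<le> h w}" if "w \<in> space N" for w
        using \<open>S = ?le \<or> S = ?lt\<close> that strict[OF i] by auto
      moreover have "distr M N (W i) = \<mu>" "space \<mu> = space N"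
        using law[OF i] by auto
      ultimately show ?thesis
        using law i I by (auto simp: q_def intro!: nn_integral_cong)
    qed
    have "emeasure M {\<omega>\<in>space M. J \<omega> = i \<and> W i \<omega> \<in> A} \<le>
        emeasure M {\<omega>\<in>space M. W i \<omega> \<in> A \<and> (\<forall>j\<in>I - {i}. (W i \<omega>, W j \<omega>) \<in> ?le)}"
      using i I max spN by (intro emeasure_mono) (auto simp: space_pair_measure)
    then show "emeasure M {\<omega>\<in>space M. J \<omega> = i \<and> W i \<omega> \<in> A} \<le> (\<integral>\<^sup>+w. indicator A w * q w \<partial>\<mu>)"
      using i I by (subst (asm) emeasure_indep_vars_comparison[OF indep]) (simp_all only: sec simp_thms, auto)
    have "emeasure M {\<omega>\<in>space M. W i \<omega> \<in> A \<and> (\<forall>j\<in>I - {i}. (W i \<omega>, W j \<omega>) \<in> ?lt)} \<le>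
        emeasure M {\<omega>\<in>space M. J \<omega> = i \<and> W i \<omega> \<in> A}"
    proof (intro emeasure_mono subsetI)
      fix \<omega> assume "\<omega> \<in> {\<omega>\<in>space M. W i \<omega> \<in> A \<and> (\<forall>j\<in>I - {i}. (W i \<omega>, W j \<omega>) \<in> ?lt)}"
      moreover from this have "J \<omega> \<in> I"
        using J by (auto simp: measurable_def)
      \<comment> \<open>If \<open>J \<omega>\<close> differed from \<open>i\<close>, the strict
        comparison at index \<open>J \<omega>\<close> would contradict \<open>max\<close>.\<close>
      ultimately show "\<omega> \<in> {\<omega>\<in>space M. J \<omega> = i \<and> W i \<omega> \<in> A}"
        using i max[of \<omega> i] by (cases "J \<omega> = i") (auto dest!: bspec[of _ _ "J \<omega>"])
    qed (use i in measurable)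
    then show "(\<integral>\<^sup>+w. indicator A w * q w \<partial>\<mu>) \<le> emeasure M {\<omega>\<in>space M. J \<omega> = i \<and> W i \<omega> \<in> A}"
      using i I by (subst (asm) emeasure_indep_vars_comparison[OF indep]) (simp_all only: sec simp_thms, auto)
  qed
  then have "(\<Sum>i\<in>I. emeasure M {\<omega>\<in>space M. J \<omega> = i \<and> W i \<omega> \<in> A}) =
      of_nat (card I) * (\<integral>\<^sup>+w. indicator A w * q w \<partial>\<mu>)"
    by simp
  moreover have "(\<Sum>i\<in>I. emeasure M {\<omega>\<in>space M. J \<omega> = i \<and> W i \<omega> \<in> A}) =
      emeasure M (\<Union>i\<in>I. {\<omega>\<in>space M. J \<omega> = i \<and> W i \<omega> \<in> A})"
    using I by (intro sum_emeasure) (auto simp: disjoint_family_on_def)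
  moreover have "(\<Union>i\<in>I. {\<omega>\<in>space M. J \<omega> = i \<and> W i \<omega> \<in> A}) = {\<omega>\<in>space M. W (J \<omega>) \<omega> \<in> A}"
    using J by (auto simp: measurable_def)
  moreover have "of_nat (card I) * (\<integral>\<^sup>+w. indicator A w * q w \<partial>\<mu>) =
      (\<integral>\<^sup>+w. of_nat (card I) * (indicator A w * q w) \<partial>\<mu>)"
  \<comment> \<open>For empty \<open>I\<close> nothing is known about \<open>\<mu>\<close>, but both
    sides vanish through \<open>card I\<close>. Otherwise the constant moves inside once
    \<open>q\<close> is known to be measurable, which holds because its base is the measure of a
    section of a product set.\<close>
  proof (cases "I = {}")
    case False
    then obtain i where i: "i \<in> I" by auto
    have [measurable_cong]: "sets \<mu> = sets N"
      using law[OF i] by auto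
    have "sigma_finite_measure \<mu>"
      using prob_space_distr[OF rv[OF i]] law[OF i] by (simp add: prob_space_imp_sigma_finite)
    then have [measurable]: "(\<lambda>w. emeasure \<mu> {v\<in>space N. h v \<le> h w}) \<in> borel_measurable N"
    proof (subst measurable_cong)
      fix w assume "w \<in> space N"
      then show "emeasure \<mu> {v\<in>space N. h v \<le> h w} =
          emeasure \<mu> (Pair w -` {p\<in>space (N \<Otimes>\<^sub>M \<mu>). h (snd p) \<le> h (fst p)})"
        using law[OF i] by (intro arg_cong2[where f=emeasure]) (auto simp: space_pair_measure)
    qed (rule sigma_finite_measure.measurable_emeasure_Pair, measurable)
    then show ?thesis
      unfolding q_def by (intro nn_integral_cmult[symmetric]) measurable
  qed simp
  ultimately show ?thesis
    by (simp add: q_def ac_simps)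
qed

section \<open>The maximum of standard normal variables\<close>

interpretation std_normal: real_distribution std_normal_distribution
  by (rule real_dist_normal_dist)

abbreviation std_normal_cdf :: "real \<Rightarrow> real" where
  "std_normal_cdf \<equiv> cdf std_normal_distribution"

lemma isCont_std_normal_density: "isCont std_normal_density x"
  unfolding std_normal_density_def[abs_def] by (intro continuous_intros) auto

lemma continuous_on_std_normal_density[continuous_intros]:
  "continuous_on A f \<Longrightarrow> continuous_on A (\<lambda>x. std_normal_density (f x))"
  unfolding std_normal_density_def by (intro continuous_intros) auto

text \<open>The fundamental theorem is applied on a compact interval. Anchoring the integral at
  \<open>x - 1\<close> makes \<open>x\<close> an interior point of \<open>{x - 1..x + 1}\<close>, so
  the derivative within the interval is a two-sided one.\<close>

lemma std_normal_cdf_has_derivative: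
  "(std_normal_cdf has_real_derivative std_normal_density x) (at x)"
proof -
  have eq: "std_normal_cdf (x - 1) + integral {x - 1..y} std_normal_density = std_normal_cdf y"
    if "x - 1 < y" for y
  proof -
    have "std_normal_cdf y - std_normal_cdf (x - 1) = measure std_normal_distribution {x - 1<..y}"
      using that by (rule std_normal.cdf_diff_eq)
    also have "\<dots> = measure std_normal_distribution {x - 1..y}"
      by (intro measure_eq_AE) (auto simp: AE_density intro!: AE_I[OF _ emeasure_lborel_singleton[of "x - 1"]])
    also have "\<dots> = (LINT t|lborel. indicator {x - 1..y} t *\<^sub>R std_normal_density t)"
    proof -
      have "emeasure std_normal_distribution {x - 1..y} =
          (\<integral>\<^sup>+t. ennreal (indicator {x - 1..y} t *\<^sub>R std_normal_density t) \<partial>lborel)"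
        by (subst emeasure_density) (auto intro!: nn_integral_cong split: split_indicator)
      also have "\<dots> = ennreal (LINT t|lborel. indicator {x - 1..y} t *\<^sub>R std_normal_density t)"
        by (intro nn_integral_eq_integral integrable_mult_indicator) auto
      finally show ?thesis
        by (simp add: measure_def integral_nonneg_AE)
    qed
    also have "\<dots> = integral {x - 1..y} std_normal_density"
      unfolding set_lebesgue_integral_def[symmetric]
      unfolding set_integrable_def
      by (intro set_borel_integral_eq_integral[unfolded set_integrable_def] integrable_mult_indicator) auto
    finally show ?thesis by simp
  qed
  have "((\<lambda>y. integral {x - 1..y} std_normal_density) has_real_derivative std_normal_density x)
      (at x within {x - 1..x + 1})"
    by (intro integral_has_real_derivative continuous_intros) auto
  then have "((\<lambda>y. integral {x - 1..y} std_normal_density) has_real_derivative std_normal_density x) (at x)"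
    by (simp add: at_within_Icc_at)
  then have "((\<lambda>y. std_normal_cdf (x - 1) + integral {x - 1..y} std_normal_density)
      has_real_derivative std_normal_density x) (at x)"
    by (auto intro!: derivative_eq_intros)
  moreover have "\<forall>\<^sub>F y in nhds x. x - 1 < y"
    by (rule order_tendstoD) (auto intro: filterlim_ident)
  then have "\<forall>\<^sub>F y in nhds x. std_normal_cdf (x - 1) + integral {x - 1..y} std_normal_density = std_normal_cdf y"
    by eventually_elim (rule eq)
  ultimately show ?thesis
    by (subst (asm) DERIV_cong_ev[OF refl _ refl]) auto
qed

lemma std_normal_cdf_strict_mono: "x < y \<Longrightarrow> std_normal_cdf x < std_normal_cdf y"
  by (rule DERIV_pos_imp_increasing)
    (use std_normal_cdf_has_derivative in \<open>auto intro!: exI normal_density_pos\<close>)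

lemma std_normal_cdf_pos: "0 < std_normal_cdf x"
  using std_normal_cdf_strict_mono[of "x - 1" x] std_normal.cdf_nonneg[of "x - 1"] by simp

lemma isCont_std_normal_cdf: "isCont std_normal_cdf x"
  using std_normal_cdf_has_derivative by (rule DERIV_isCont)

lemma borel_measurable_std_normal_cdf[measurable]: "std_normal_cdf \<in> borel_measurable borel"
  by (intro borel_measurable_continuous_onI continuous_at_imp_continuous_on ballI isCont_std_normal_cdf)

section \<open>Density, moments and positive mean of the maximum\<close>

definition normal_max_density :: "nat \<Rightarrow> real \<Rightarrow> real" where
  "normal_max_density n x = real n * std_normal_density x * std_normal_cdf x ^ (n - 1)"

text \<open>Given by the derivative of \<open>std_normal_cdf x ^ n\<close> and not as the image of a
  maximum, because selection by \<open>J\<close> produces exactly this density. For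
  \<open>n = 0\<close> it is the zero measure.\<close>

definition normal_max :: "nat \<Rightarrow> real measure" where
  "normal_max n = density lborel (normal_max_density n)"

lemma borel_measurable_normal_max_density[measurable]: "normal_max_density n \<in> borel_measurable borel"
  unfolding normal_max_density_def by measurable

lemma normal_max_density_nonneg[simp]: "0 \<le> normal_max_density n x"
  by (simp add: normal_max_density_def std_normal.cdf_nonneg)

lemma normal_max_density_pos: "0 < n \<Longrightarrow> 0 < normal_max_density n x"
  by (simp add: normal_max_density_def std_normal_cdf_pos normal_density_pos)

lemma sets_normal_max[simp, measurable_cong]: "sets (normal_max n) = sets borel"
  by (simp add: normal_max_def)

lemma space_normal_max[simp]: "space (normal_max n) = UNIV"
  by (simp add: normal_max_def)

lemma prob_space_normal_max:
  assumes "0 < n"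
  shows "prob_space (normal_max n)"
proof -
  have deriv: "((\<lambda>x. std_normal_cdf x ^ n) has_real_derivative normal_max_density n x) (at x)" for x
    using std_normal_cdf_has_derivative[of x] unfolding normal_max_density_def
    by (auto intro!: derivative_eq_intros)
  have top: "((\<lambda>x. std_normal_cdf x ^ n) \<longlongrightarrow> 1 ^ n) at_top"
    by (intro tendsto_intros std_normal.cdf_lim_at_top_prob)
  \<comment> \<open>The limit \<open>0 ^ n\<close> is 0 because \<open>0 < n\<close>; this gives
    total mass \<open>1 - 0\<close>.\<close>
  have bot: "((\<lambda>x. std_normal_cdf x ^ n) \<longlongrightarrow> 0 ^ n) at_bot"
    by (intro tendsto_intros std_normal.cdf_lim_at_bot)
  have cont: "isCont (normal_max_density n) x" for x
    unfolding normal_max_density_def[abs_def]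
    by (intro continuous_intros isCont_std_normal_cdf isCont_std_normal_density)
  note ftc = interval_integral_FTC_nonneg[of "-\<infinity>" \<infinity> "\<lambda>x. std_normal_cdf x ^ n"
      "normal_max_density n" 0 1, OF _ deriv cont AE_I2]
  have int: "set_integrable lborel (einterval (-\<infinity>) \<infinity>) (normal_max_density n)"
    using top bot assms by (intro ftc(1)) (auto simp: ereal_tendsto_simps1 intro: std_normal.cdf_lim_at_bot)
  have eq: "(LBINT x=-\<infinity>..\<infinity>. normal_max_density n x) = 1 - 0"
    using top bot assms by (intro ftc(2)) (auto simp: ereal_tendsto_simps1 intro: std_normal.cdf_lim_at_bot)
  have "integrable lborel (normal_max_density n)" "(LINT x|lborel. normal_max_density n x) = 1"
    using int eq by (auto simp: set_integrable_def interval_lebesgue_integral_def set_lebesgue_integral_def)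
  then have "emeasure (normal_max n) UNIV = 1"
    by (simp add: normal_max_def emeasure_density nn_integral_eq_integral)
  then show ?thesis
    by (intro prob_spaceI) simp
qed

lemma normal_max_density_le: "normal_max_density n x \<le> real n * std_normal_density x"
  unfolding normal_max_density_def
  by (intro mult_right_le_one_le power_le_one) (auto simp: std_normal.cdf_nonneg std_normal.cdf_bounded_prob)

text \<open>Domination by \<open>n\<close> times the normal density transfers integrability, so all
  moments of the maximum exist.\<close>

lemma integrable_normal_max:
  fixes g :: "real \<Rightarrow> real"
  assumes "integrable std_normal_distribution g"
  shows "integrable (normal_max n) g"
proof -
  have [measurable]: "g \<in> borel_measurable borel"
    using assms by (auto dest: borel_measurable_integrable)
  have "integrable lborel (\<lambda>x. real n * (std_normal_density x * g x))"
    using assms by (auto simp: integrable_density)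
  then have "integrable lborel (\<lambda>x. normal_max_density n x * g x)"
  proof (rule Bochner_Integration.integrable_bound)
    show "AE x in lborel. norm (normal_max_density n x * g x) \<le> norm (real n * (std_normal_density x * g x))"
    proof (rule AE_I2)
      fix x
      have "normal_max_density n x * \<bar>g x\<bar> \<le> real n * std_normal_density x * \<bar>g x\<bar>"
        by (intro mult_right_mono normal_max_density_le) auto
      then show "norm (normal_max_density n x * g x) \<le> norm (real n * (std_normal_density x * g x))"
        by (simp add: abs_mult mult.assoc)
    qed
  qed measurable
  then show ?thesis
    unfolding normal_max_def by (subst integrable_density) auto
qed

lemma integral_normal_max:
  assumes [measurable]: "g \<in> borel_measurable borel"
  shows "(LINT x|normal_max n. g x) = (LINT x|lborel. normal_max_density n x * g x)"
  unfolding normal_max_def by (subst integral_density) auto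

lemma integrable_normal_max_power: "integrable (normal_max n) (\<lambda>x. x ^ k)"
  by (intro integrable_normal_max integrable_std_normal_distribution_moment)

definition normal_max_mean :: "nat \<Rightarrow> real" where
  "normal_max_mean n = (LINT x|normal_max n. x)"

text \<open>The estimator divides by this mean. Since \<open>x\<close> integrates to 0 against the
  normal density, the constant \<open>c\<close>, the value of
  \<open>std_normal_cdf x ^ (n - 1)\<close> at 0, may be subtracted for free. The power is strictly
  increasing for \<open>n \<ge> 2\<close>, so the new integrand is positive off 0; for
  \<open>n = 1\<close> the mean is 0.\<close>

lemma normal_max_mean_pos:
  assumes "2 \<le> n"
  shows "0 < normal_max_mean n"
proof -
  define c where "c = std_normal_cdf 0 ^ (n - 1)"
  define h where "h x = real n * std_normal_density x * (x * (std_normal_cdf x ^ (n - 1) - c))" for x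
  have h_pos: "0 < h x" if "x \<noteq> 0" for x
  proof -
    have "0 < x * (std_normal_cdf x ^ (n - 1) - c)"
    proof (cases "x < 0")
      case True
      then have "std_normal_cdf x ^ (n - 1) < c"
        using assms unfolding c_def
        by (intro power_strict_mono std_normal_cdf_strict_mono std_normal.cdf_nonneg) auto
      then show ?thesis using True by (intro mult_neg_neg) auto
    next
      case False
      then have "c < std_normal_cdf x ^ (n - 1)"
        using assms that unfolding c_def
        by (intro power_strict_mono std_normal_cdf_strict_mono std_normal.cdf_nonneg) auto
      then show ?thesis using False that by (intro mult_pos_pos) auto
    qed
    then show ?thesis
      using assms by (simp add: h_def normal_density_pos)
  qed
  have h_eq: "h x = normal_max_density n x * x - real n * c * (std_normal_density x * x)" for x
    by (simp add: h_def normal_max_density_def algebra_simps)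
  have i1: "integrable lborel (\<lambda>x. normal_max_density n x * x)"
    using integrable_normal_max_power[of n 1] by (simp add: normal_max_def integrable_density)
  have i2: "integrable lborel (\<lambda>x. std_normal_density x * x)"
    using integrable_std_normal_moment[of 1] by simp
  have int: "integrable lborel h"
    unfolding h_eq[abs_def] using i1 i2 by (intro Bochner_Integration.integrable_diff integrable_mult_right)
  have "(LINT x|lborel. h x) = normal_max_mean n - real n * c * (LINT x|lborel. std_normal_density x * x)"
    unfolding h_eq normal_max_mean_def
    using i1 i2 by (simp add: integral_normal_max)
  also have "(LINT x|lborel. std_normal_density x * x) = 0"
    using integral_std_normal_moment_odd[of 0] by simp
  finally have eq: "normal_max_mean n = (LINT x|lborel. h x)" by simp
  have nonneg: "AE x in lborel. 0 \<le> h x"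
    using h_pos by (intro AE_I2) (metis h_def less_eq_real_def mult_zero_left mult_zero_right)
  have "(LINT x|lborel. h x) \<noteq> 0"
  proof
    assume "(LINT x|lborel. h x) = 0"
    then have "AE x in lborel. h x = 0"
      using integral_nonneg_eq_0_iff_AE[OF int nonneg] by simp
    then have "AE x in (lborel :: real measure). False"
      using AE_lborel_singleton[of "0 :: real"] by eventually_elim (use h_pos in force)
    then show False
      by (simp add: trivial_limit_def[symmetric] ae_filter_eq_bot_iff)
  qed
  then show ?thesis
    unfolding eq using integral_nonneg_AE[OF nonneg] by simp
qed

section \<open>Mean-square convergence of the maximum\<close>

lemma normal_max_second_moment_about:
  assumes "2 \<le> n"
  shows "(LINT x|normal_max n. (x - b)\<^sup>2) =
    (LINT x|normal_max n. (x - normal_max_mean n)\<^sup>2) + (normal_max_mean n - b)\<^sup>2"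
proof -
  interpret prob_space "normal_max n"
    using assms by (intro prob_space_normal_max) auto
  have *: "integrable (normal_max n) (\<lambda>x. x)" "integrable (normal_max n) (\<lambda>x. x\<^sup>2)"
    using integrable_normal_max_power[of n 1] integrable_normal_max_power[of n 2] by auto
  \<comment> \<open>Used with \<open>c = b\<close> and with \<open>c\<close> the mean; eliminating
    the raw second moment gives the bias-variance decomposition. Both of its summands are
    nonnegative, so one limit later controls variance and bias together.\<close>
  have "(LINT x|normal_max n. (x - c)\<^sup>2) =
      (LINT x|normal_max n. x\<^sup>2) - 2 * c * normal_max_mean n + c\<^sup>2" for c
    using * by (simp add: power2_diff normal_max_mean_def prob_space[simplified])
  from this[of b] this[of "normal_max_mean n"] show ?thesis
    by (simp only: power2_eq_square) (simp only: algebra_simps)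
qed

text \<open>Right of \<open>a\<close> the density of the maximum is at most \<open>n\<close> times the normal density,
  and \<open>n = exp (a\<^sup>2 / 2)\<close> makes this equal to \<open>std_normal_density (x - a) * exp (- a (x - a))\<close>.\<close>

lemma normal_max_second_moment_le:
  fixes n :: nat and \<delta> :: real
  defines "a \<equiv> sqrt (2 * ln (real n))"
  assumes n: "2 \<le> n" and \<delta>: "0 \<le> \<delta>"
  shows "(LINT x|normal_max n. (x - a)\<^sup>2) \<le>
    \<delta>\<^sup>2 + real n * (a\<^sup>2 + 1) * std_normal_cdf (a - \<delta>) ^ (n - 1) + 2 / a\<^sup>2"
proof -
  interpret prob_space "normal_max n"
    using n by (intro prob_space_normal_max) auto
  have a: "0 < a" "real n = exp (a\<^sup>2 / 2)"
    using n by (auto simp: a_def)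
  define C where "C = real n * std_normal_cdf (a - \<delta>) ^ (n - 1)"
  have "0 \<le> C"
    by (simp add: C_def std_normal.cdf_nonneg)
  \<comment> \<open>Each summand dominates on one region: the second left of
    \<open>a - \<delta>\<close>, where the power is at most its value there, the first between
    \<open>a - \<delta>\<close> and \<open>a\<close>, the third right of \<open>a\<close>. All are
    nonnegative, so the sum dominates everywhere.\<close>
  have pw: "normal_max_density n x * (x - a)\<^sup>2 \<le> \<delta>\<^sup>2 * normal_max_density n x +
      C * (std_normal_density x * (x - a)\<^sup>2) + 2 / a\<^sup>2 * normal_density a 1 x" for x
  proof -
    have nonneg: "0 \<le> \<delta>\<^sup>2 * normal_max_density n x" "0 \<le> C * (std_normal_density x * (x - a)\<^sup>2)"
      "0 \<le> 2 / a\<^sup>2 * normal_density a 1 x"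
      using \<open>0 \<le> C\<close> by (auto simp: normal_density_nonneg)
    consider "x \<le> a - \<delta>" | "a - \<delta> < x" "x \<le> a" | "a < x" by linarith
    then show ?thesis
    proof cases
      case 1
      have "normal_max_density n x \<le> C * std_normal_density x"
      proof -
        have "std_normal_cdf x ^ (n - 1) \<le> std_normal_cdf (a - \<delta>) ^ (n - 1)"
          by (intro power_mono std_normal.cdf_nondecreasing 1 std_normal.cdf_nonneg)
        then have "real n * std_normal_density x * std_normal_cdf x ^ (n - 1) \<le>
            real n * std_normal_density x * std_normal_cdf (a - \<delta>) ^ (n - 1)"
          by (intro mult_left_mono) auto
        then show ?thesis
          by (simp only: normal_max_density_def C_def mult_ac)
      qed
      then have "normal_max_density n x * (x - a)\<^sup>2 \<le> C * std_normal_density x * (x - a)\<^sup>2"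
        by (intro mult_right_mono) auto
      then show ?thesis using nonneg unfolding mult.assoc by linarith
    next
      case 2
      then have "(x - a)\<^sup>2 \<le> \<delta>\<^sup>2"
        by (intro power2_le_iff_abs_le[THEN iffD2]) (use \<delta> in auto)
      then have "normal_max_density n x * (x - a)\<^sup>2 \<le> normal_max_density n x * \<delta>\<^sup>2"
        by (intro mult_left_mono) auto
      then show ?thesis using nonneg unfolding mult.commute[of _ "\<delta>\<^sup>2"] by linarith
    next
      case 3
      \<comment> \<open>Beyond \<open>a\<close> the natural length scale is \<open>1 / a\<close>.
        The bound \<open>1 + u + u^2 / 2 \<le> exp u\<close> yields the 2 in
        \<open>2 / a^2\<close>.\<close>
      define u where "u = a * (x - a)"
      have u: "0 \<le> u" using 3 a by (simp add: u_def)
      have "u\<^sup>2 \<le> 2 * exp u"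
        using exp_lower_Taylor_quadratic[OF u] u by simp
      then have "u\<^sup>2 * exp (- u) \<le> 2"
        by (simp add: exp_minus field_simps)
      then have "(x - a)\<^sup>2 * exp (- u) \<le> 2 / a\<^sup>2"
        using a by (simp add: u_def power_mult_distrib pos_le_divide_eq mult_ac)
      then have "normal_density a 1 x * ((x - a)\<^sup>2 * exp (- u)) \<le> normal_density a 1 x * (2 / a\<^sup>2)"
        by (intro mult_left_mono) (auto simp: normal_density_nonneg)
      moreover have "real n * std_normal_density x = normal_density a 1 x * exp (- u)"
        unfolding a(2) u_def normal_density_def
        by (simp add: exp_add[symmetric] power2_eq_square field_simps)
      moreover have "normal_max_density n x * (x - a)\<^sup>2 \<le> real n * std_normal_density x * (x - a)\<^sup>2"
        by (intro mult_right_mono normal_max_density_le) auto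
      ultimately have "normal_max_density n x * (x - a)\<^sup>2 \<le> 2 / a\<^sup>2 * normal_density a 1 x"
        by (simp add: mult_ac)
      then show ?thesis
        using nonneg by linarith
    qed
  qed
  have m: "integrable lborel (\<lambda>x. std_normal_density x * x)" "integrable lborel (\<lambda>x. std_normal_density x * x\<^sup>2)"
    using integrable_std_normal_moment[of 1] integrable_std_normal_moment[of 2] by auto
  have sq: "std_normal_density x * (x - a)\<^sup>2 = std_normal_density x * x\<^sup>2
      - 2 * a * (std_normal_density x * x) + a\<^sup>2 * std_normal_density x" for x
    by (simp add: power2_diff algebra_simps)
  have i2: "integrable lborel (\<lambda>x. std_normal_density x * (x - a)\<^sup>2)"
    unfolding sq using m by auto
  have "(LINT x|lborel. std_normal_density x * (x - a)\<^sup>2) = (LINT x|lborel. std_normal_density x * x\<^sup>2)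
      - 2 * a * (LINT x|lborel. std_normal_density x * x) + a\<^sup>2"
    unfolding sq using m by simp
  then have e2: "(LINT x|lborel. std_normal_density x * (x - a)\<^sup>2) = a\<^sup>2 + 1"
    using integral_std_normal_moment_odd[of 0] integral_std_normal_moment_even[of 1] by simp
  have "integrable (normal_max n) (\<lambda>x. 1 :: real)" "(LINT x|normal_max n. 1 :: real) = 1"
    by (auto simp: prob_space[simplified])
  then have i1: "integrable lborel (normal_max_density n)" "(LINT x|lborel. normal_max_density n x) = 1"
    using integral_normal_max[of "\<lambda>_. 1" n] by (auto simp: normal_max_def integrable_density)
  have "integrable (normal_max n) (\<lambda>x. x\<^sup>2 - 2 * a * x + a\<^sup>2)"
    using integrable_normal_max_power[of n 1] integrable_normal_max_power[of n 2] by auto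
  then have i0: "integrable lborel (\<lambda>x. normal_max_density n x * (x - a)\<^sup>2)"
    by (simp add: normal_max_def integrable_density power2_diff algebra_simps)
  have "(LINT x|normal_max n. (x - a)\<^sup>2) = (LINT x|lborel. normal_max_density n x * (x - a)\<^sup>2)"
    by (intro integral_normal_max) auto
  also have "\<dots> \<le> (LINT x|lborel. \<delta>\<^sup>2 * normal_max_density n x +
      C * (std_normal_density x * (x - a)\<^sup>2) + 2 / a\<^sup>2 * normal_density a 1 x)"
    using i0 i1 i2 by (intro integral_mono pw) auto
  also have "\<dots> = \<delta>\<^sup>2 + C * (a\<^sup>2 + 1) + 2 / a\<^sup>2"
    using i1 i2 e2 by simp
  finally show ?thesis by (simp add: C_def mult_ac)
qed

text \<open>A cheap substitute for the Mills ratio: of the tail beyond \<open>a - 2 * d\<close> only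
  the mass up to \<open>a - d\<close> is counted, an interval of length \<open>d\<close>. The
  condition \<open>2 * d \<le> a\<close> keeps this interval in the half-line where the density
  decreases, so its smallest value is at \<open>a - d\<close>.\<close>

lemma std_normal_cdf_gap:
  assumes "0 < d" "2 * d \<le> a"
  shows "std_normal_cdf (a - 2 * d) \<le> 1 - d * std_normal_density (a - d)"
proof -
  obtain z where z: "a - 2 * d < z" "z < a - d"
    "std_normal_cdf (a - d) - std_normal_cdf (a - 2 * d) = (a - d - (a - 2 * d)) * std_normal_density z"
    using MVT2[of "a - 2 * d" "a - d" std_normal_cdf std_normal_density] assms
      std_normal_cdf_has_derivative by auto
  have "z\<^sup>2 \<le> (a - d)\<^sup>2"
    using z assms by (intro power_mono) auto
  then have "std_normal_density (a - d) \<le> std_normal_density z"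
    unfolding std_normal_density_def by (intro mult_left_mono) auto
  then have "d * std_normal_density (a - d) \<le> d * std_normal_density z"
    using assms by (intro mult_left_mono) auto
  also have "d * std_normal_density z = std_normal_cdf (a - d) - std_normal_cdf (a - 2 * d)"
    using z(3) by simp
  finally show ?thesis
    using std_normal.cdf_bounded_prob[of "a - d"] by simp
qed

text \<open>The preceding bound is used with a fixed \<open>\<delta> = 2 * d\<close>. It suffices
  that the remaining terms vanish for each fixed \<open>d\<close>, and they do because
  \<open>exp (t * d)\<close> outgrows \<open>t^2 / 2\<close>.\<close>

lemma normal_max_second_moment_tendsto:
  "(\<lambda>n. LINT x|normal_max n. (x - sqrt (2 * ln (real n)))\<^sup>2) \<longlonglongrightarrow> 0"
proof (rule order_tendstoI)
  fix e :: real
  assume "e < 0"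
  then show "\<forall>\<^sub>F n in sequentially. e < (LINT x|normal_max n. (x - sqrt (2 * ln (real n)))\<^sup>2)"
    by (auto intro!: always_eventually less_le_trans[OF _ integral_nonneg_AE])
next
  fix e :: real
  assume e: "0 < e"
  \<comment> \<open>Chosen so that \<open>\<delta>^2 = (2 * d)^2\<close> uses up half of
    \<open>e\<close>.\<close>
  define d where "d = sqrt (e / 8)"
  have d: "0 < d" "(2 * d)\<^sup>2 = e / 2"
    using e by (auto simp: d_def power_mult_distrib)
  \<comment> \<open>From \<open>n / 2 * d * std_normal_density (a - d)\<close> with
    \<open>n = exp (a^2 / 2)\<close>: the exponents combine to \<open>a * d - d^2 / 2\<close>. The
    halving comes from \<open>n - 1 \<ge> n / 2\<close>.\<close>
  define c where "c = d * exp (- d\<^sup>2 / 2) / (2 * sqrt (2 * pi))"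
  have c: "0 < c"
    using d by (simp add: c_def)
  define a where "a n = sqrt (2 * ln (real n))" for n :: nat
  \<comment> \<open>The bound without \<open>\<delta>^2\<close>, written in the single real variable
    \<open>t = a n\<close> so that its limit is one of elementary functions.\<close>
  define B where "B t = exp (t\<^sup>2 / 2) * (t\<^sup>2 + 1) * exp (- (c * exp (t * d))) + 2 / t\<^sup>2" for t :: real
  have a_top: "filterlim a at_top sequentially"
    unfolding a_def by real_asymp
  have "(B \<longlongrightarrow> 0) at_top"
    unfolding B_def using c d(1) by real_asymp
  then have "(\<lambda>n. B (a n)) \<longlonglongrightarrow> 0"
    using a_top by (rule filterlim_compose)
  then have "\<forall>\<^sub>F n in sequentially. B (a n) < e / 2"
    using e by (intro order_tendstoD) auto
  moreover have "\<forall>\<^sub>F n in sequentially. 2 * d \<le> a n"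
    using a_top by (simp add: filterlim_at_top)
  ultimately show "\<forall>\<^sub>F n in sequentially. (LINT x|normal_max n. (x - sqrt (2 * ln (real n)))\<^sup>2) < e"
    using eventually_ge_at_top[of 2]
  proof eventually_elim
    case (elim n)
    have n: "real n = exp ((a n)\<^sup>2 / 2)"
      using elim(3) by (auto simp: a_def)
    define q where "q = d * std_normal_density (a n - d)"
    have "0 \<le> q"
      using d by (simp add: q_def)
    have "std_normal_cdf (a n - 2 * d) \<le> exp (- q)"
      using std_normal_cdf_gap[OF d(1) elim(2)] exp_ge_add_one_self[of "- q"] by (simp add: q_def)
    then have "std_normal_cdf (a n - 2 * d) ^ (n - 1) \<le> exp (- q) ^ (n - 1)"
      by (intro power_mono std_normal.cdf_nonneg)
    also have "\<dots> = exp (- (real (n - 1) * q))"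
      by (simp add: exp_of_nat_mult[symmetric])
    also have "\<dots> \<le> exp (- (real n / 2 * q))"
      using elim(3) \<open>0 \<le> q\<close>
      by (simp only: exp_le_cancel_iff neg_le_iff_le) (intro mult_right_mono, auto)
    also have "real n / 2 * q = c * exp (a n * d)"
      unfolding n q_def c_def std_normal_density_def
      by (simp add: exp_add[symmetric] field_simps power2_eq_square)
    finally have "real n * ((a n)\<^sup>2 + 1) * std_normal_cdf (a n - 2 * d) ^ (n - 1) \<le>
        real n * ((a n)\<^sup>2 + 1) * exp (- (c * exp (a n * d)))"
      by (intro mult_left_mono) auto
    then have "(2 * d)\<^sup>2 + real n * ((a n)\<^sup>2 + 1) * std_normal_cdf (a n - 2 * d) ^ (n - 1) + 2 / (a n)\<^sup>2
        \<le> e / 2 + B (a n)"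
      unfolding B_def d(2) n[symmetric] by simp
    also have "\<dots> < e"
      using elim(1) by simp
    finally show ?case
      using normal_max_second_moment_le[OF elim(3), of "2 * d"] d(1) by (simp add: a_def)
  qed
qed

definition normal_max_variance :: "nat \<Rightarrow> real" where
  "normal_max_variance n = (LINT x|normal_max n. (x - normal_max_mean n)\<^sup>2)"

lemma normal_max_variance_tendsto: "normal_max_variance \<longlonglongrightarrow> 0"
proof (rule tendsto_sandwich[OF _ _ tendsto_const normal_max_second_moment_tendsto])
  show "\<forall>\<^sub>F n in sequentially. normal_max_variance n \<le> (LINT x|normal_max n. (x - sqrt (2 * ln (real n)))\<^sup>2)"
    using eventually_ge_at_top[of 2]
    by eventually_elim (subst normal_max_second_moment_about, auto simp: normal_max_variance_def)
qed (simp add: normal_max_variance_def integral_nonneg_AE)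

lemma normal_max_mean_tendsto:
  "(\<lambda>n. normal_max_mean n - sqrt (2 * ln (real n))) \<longlonglongrightarrow> 0"
proof -
  have "(\<lambda>n. (normal_max_mean n - sqrt (2 * ln (real n)))\<^sup>2) \<longlonglongrightarrow> 0"
  proof (rule tendsto_sandwich[OF _ _ tendsto_const normal_max_second_moment_tendsto])
    show "\<forall>\<^sub>F n in sequentially. (normal_max_mean n - sqrt (2 * ln (real n)))\<^sup>2 \<le>
        (LINT x|normal_max n. (x - sqrt (2 * ln (real n)))\<^sup>2)"
      using eventually_ge_at_top[of 2]
      by eventually_elim (subst normal_max_second_moment_about, auto simp: integral_nonneg_AE)
  qed simp
  then show ?thesis
    by simp
qed

section \<open>The law of the maximum statistic\<close>

lemma borel_measurable_fst_snd_real[measurable]: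
  "fst \<in> borel_measurable (borel :: (real \<times> real) measure)"
  "snd \<in> borel_measurable (borel :: (real \<times> real) measure)"
  unfolding borel_prod[symmetric] by measurable

definition gaussian_map :: "real \<Rightarrow> real \<times> real \<Rightarrow> real \<times> real" where
  "gaussian_map \<rho> p = (fst p, \<rho> * fst p + sqrt (1 - \<rho>\<^sup>2) * snd p)"

lemma borel_measurable_gaussian_map[measurable]: "gaussian_map \<rho> \<in> borel_measurable (borel \<Otimes>\<^sub>M borel)"
  unfolding gaussian_map_def[abs_def] by measurable

definition gaussian_pair_law :: "real \<Rightarrow> (real \<times> real) measure" where
  "gaussian_pair_law \<rho> = distr (std_normal_distribution \<Otimes>\<^sub>M std_normal_distribution) borel (gaussian_map \<rho>)"

lemma sets_gaussian_pair_law[simp, measurable_cong]: "sets (gaussian_pair_law \<rho>) = sets borel"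
  by (simp add: gaussian_pair_law_def)

text \<open>The noise \<open>Z\<close> is given separately for each \<open>i\<close>; its joint law
  with \<open>X i\<close> determines the law of the pair, for which the almost sure identity is
  enough.\<close>

lemma gaussian_pairs_law:
  assumes "gaussian_pairs M \<rho> X Y" "1 \<le> i"
  shows "distr M borel (\<lambda>\<omega>. (X i \<omega>, Y i \<omega>)) = gaussian_pair_law \<rho>"
proof -
  interpret prob_space M
    using assms by (simp add: gaussian_pairs_def)
  obtain Z where X: "distributed M lborel (X i) std_normal_density"
    and Z: "distributed M lborel Z std_normal_density" and ind: "indep_var borel (X i) borel Z"
    and Y: "AE \<omega> in M. Y i \<omega> = \<rho> * X i \<omega> + sqrt (1 - \<rho>\<^sup>2) * Z \<omega>"
    using assms by (auto simp: gaussian_pairs_def)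
  have [measurable]: "(\<lambda>\<omega>. (X i \<omega>, Y i \<omega>)) \<in> borel_measurable M"
    using assms by (auto simp: gaussian_pairs_def indep_vars_def)
  have [measurable]: "X i \<in> borel_measurable M" "Z \<in> borel_measurable M"
    using ind by (auto simp: indep_var_distribution_eq)
  have "distr M borel (X i) = distr M lborel (X i)" "distr M borel Z = distr M lborel Z"
    by (auto intro: distr_cong)
  then have marg: "distr M borel (X i) = std_normal_distribution" "distr M borel Z = std_normal_distribution"
    using X Z by (auto simp: distributed_def)
  have "distr M borel (\<lambda>\<omega>. (X i \<omega>, Y i \<omega>)) = distr M borel (\<lambda>\<omega>. gaussian_map \<rho> (X i \<omega>, Z \<omega>))"
    using Y by (intro distr_cong_AE) (auto simp: gaussian_map_def)
  also have "\<dots> = distr (distr M (borel \<Otimes>\<^sub>M borel) (\<lambda>\<omega>. (X i \<omega>, Z \<omega>))) borel (gaussian_map \<rho>)"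
    by (subst distr_distr) (auto simp: comp_def)
  also have "\<dots> = gaussian_pair_law \<rho>"
    using ind marg by (simp add: indep_var_distribution_eq gaussian_pair_law_def)
  finally show ?thesis .
qed

text \<open>Serves twice: with a singleton for the absence of atoms of the score, with a half-line
  for its distribution function.\<close>

lemma emeasure_gaussian_pair_law_fst:
  assumes [measurable]: "B \<in> sets borel"
  shows "emeasure (gaussian_pair_law \<rho>) {w\<in>space borel. fst w \<in> B} = emeasure std_normal_distribution B"
proof -
  have [measurable]: "{w\<in>space borel. fst w \<in> B} \<in> sets (borel :: (real \<times> real) measure)"
    unfolding borel_prod[symmetric] by measurable
  have "emeasure (gaussian_pair_law \<rho>) {w\<in>space borel. fst w \<in> B} =
      emeasure (std_normal_distribution \<Otimes>\<^sub>M std_normal_distribution) (B \<times> UNIV)"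
    unfolding gaussian_pair_law_def
    by (subst emeasure_distr, measurable)
      (auto simp: gaussian_map_def space_pair_measure intro!: arg_cong2[where f=emeasure])
  then show ?thesis
    using std_normal.emeasure_space_1 by (simp add: std_normal.emeasure_pair_measure_Times)
qed

text \<open>A Hilbert choice is not measurable by form. Here it is a function of the set
  \<open>best\<close> of maximisers, which takes finitely many values, each on a measurable event;
  any function of such a discrete variable is measurable.\<close>

lemma measurable_max_index:
  assumes X: "\<And>i. 1 \<le> i \<Longrightarrow> X i \<in> borel_measurable M"
  shows "max_index X k \<in> measurable M (count_space {1..2 ^ k})"
proof -
  define I where "I = {1..2 ^ k :: nat}"
  define top where "top \<omega> i \<longleftrightarrow> (\<forall>j\<in>I. X j \<omega> \<le> X i \<omega>)" for \<omega> i
  define best where "best \<omega> = {i \<in> I. top \<omega> i}" for \<omega>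
  have I: "finite I"
    by (simp add: I_def)
  have "best \<in> measurable M (count_space (Pow I))"
  proof (rule measurable_count_space_eq2[THEN iffD2])
    have "best -` {a} \<inter> space M \<in> sets M" if "a \<in> Pow I" for a
    proof -
      have "best -` {a} \<inter> space M = {\<omega>\<in>space M. \<forall>i\<in>I. i \<in> a \<longleftrightarrow> top \<omega> i}"
        using that unfolding best_def by blast
      also have "\<dots> \<in> sets M"
      proof (intro sets.sets_Collect_finite_All I)
        fix i assume "i \<in> I"
        then have best: "{\<omega>\<in>space M. top \<omega> i} \<in> sets M"
          unfolding top_def using I by (intro sets.sets_Collect_finite_All borel_measurable_le) (auto simp: I_def X)
        then show "{\<omega>\<in>space M. i \<in> a \<longleftrightarrow> top \<omega> i} \<in> sets M"
          using sets.sets_Collect_neg[OF best] by (cases "i \<in> a") simp_all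
      qed
      finally show ?thesis .
    qed
    then show "best \<in> space M \<rightarrow> Pow I \<and> (\<forall>a\<in>Pow I. best -` {a} \<inter> space M \<in> sets M)"
      by (auto simp: best_def)
  qed (simp add: I)
  then have "(\<lambda>\<omega>. SOME i. i \<in> best \<omega>) \<in> measurable M (count_space UNIV)"
    by (rule measurable_compose) simp
  moreover have "max_index X k = (\<lambda>\<omega>. SOME i. i \<in> best \<omega>)"
  proof
    fix \<omega>
    have "is_arg_max (\<lambda>i. X i \<omega>) (\<lambda>i. i \<in> I) = (\<lambda>i. i \<in> best \<omega>)"
      by (auto simp: is_arg_max_linorder best_def top_def)
    then show "max_index X k \<omega> = (SOME i. i \<in> best \<omega>)"
      by (simp add: max_index_def arg_max_on_def arg_max_def I_def)
  qed
  ultimately have "max_index X k \<in> measurable M (count_space UNIV)"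
    by simp
  then have "max_index X k -` {i} \<inter> space M \<in> sets M" for i
    by (rule measurable_sets) simp
  then have "max_index X k \<in> space M \<rightarrow> {1..2 ^ k} \<and>
      (\<forall>i\<in>{1..2 ^ k}. max_index X k -` {i} \<inter> space M \<in> sets M)"
    using max_index_in[of X k] by (intro conjI Pi_I ballI)
  then show ?thesis
    by (rule measurable_count_space_eq2[THEN iffD2, OF finite_atLeastAtMost])
qed

lemma measurable_max_statistic:
  assumes "gaussian_pairs M \<rho> X Y"
  shows "max_statistic X Y k \<in> borel_measurable M"
proof -
  have pair: "1 \<le> i \<Longrightarrow> (\<lambda>\<omega>. (X i \<omega>, Y i \<omega>)) \<in> borel_measurable M" for i
    using assms unfolding gaussian_pairs_def by (auto simp: prob_space.indep_vars_def)
  have "X i \<in> borel_measurable M" if "1 \<le> i" for i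
    using measurable_compose[OF pair[OF that], of fst borel] by (simp add: borel_prod[symmetric])
  then have J: "max_index X k \<in> measurable M (count_space {1..2 ^ k})"
    by (rule measurable_max_index)
  have "(\<lambda>\<omega>. (\<lambda>i \<omega>. (X i \<omega>, Y i \<omega>)) (max_index X k \<omega>) \<omega>) \<in> borel_measurable M"
    by (rule measurable_compose_countable'[OF _ J]) (auto intro!: pair)
  then show ?thesis
    by (simp add: max_statistic_def[abs_def])
qed

text \<open>\<open>emeasure_argmax\<close> with score \<open>fst\<close> weights the pair law by a
  function \<open>c\<close> of the first coordinate. As \<open>gaussian_map\<close> keeps that
  coordinate, the weight pulls back to the first normal factor alone and turns its density into
  \<open>normal_max_density\<close>.\<close>

lemma distr_max_statistic:
  assumes gp: "gaussian_pairs M \<rho> X Y"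
  shows "distr M borel (max_statistic X Y k) =
    distr (normal_max (2 ^ k) \<Otimes>\<^sub>M std_normal_distribution) borel (gaussian_map \<rho>)"
proof (rule measure_eqI)
  interpret prob_space M
    using gp by (simp add: gaussian_pairs_def)
  let ?N = "std_normal_distribution"
  let ?n = "2 ^ k :: nat"
  have indep: "indep_vars (\<lambda>_. borel) (\<lambda>i \<omega>. (X i \<omega>, Y i \<omega>)) {1..?n}"
  proof (rule indep_vars_subset)
    show "indep_vars (\<lambda>_. borel) (\<lambda>i \<omega>. (X i \<omega>, Y i \<omega>)) {1..}"
      using gp by (simp add: gaussian_pairs_def)
  qed auto
  have X: "X i \<in> borel_measurable M" if "1 \<le> i" for i
    using gp that by (auto simp: gaussian_pairs_def distributed_def)
  fix A assume "A \<in> sets (distr M borel (max_statistic X Y k))"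
  then have A[measurable]: "A \<in> sets (borel :: (real \<times> real) measure)"
    by simp
  define c where "c x = ennreal (real ?n * std_normal_cdf x ^ (?n - 1))" for x
  have [measurable]: "c \<in> borel_measurable borel"
    unfolding c_def by measurable
  have "emeasure (distr M borel (max_statistic X Y k)) A =
      emeasure M {\<omega>\<in>space M. (X (max_index X k \<omega>) \<omega>, Y (max_index X k \<omega>) \<omega>) \<in> A}"
    using measurable_max_statistic[OF gp]
    by (subst emeasure_distr) (auto simp: max_statistic_def intro!: arg_cong2[where f=emeasure])
  also have "\<dots> = (\<integral>\<^sup>+w. of_nat (card {1..?n}) *
      emeasure (gaussian_pair_law \<rho>) {v\<in>space borel. fst v \<le> fst w} ^ (card {1..?n} - 1) * indicator A w
      \<partial>gaussian_pair_law \<rho>)"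
  proof (rule emeasure_argmax[OF indep])
    show "distr M borel (\<lambda>\<omega>. (X i \<omega>, Y i \<omega>)) = gaussian_pair_law \<rho>" if "i \<in> {1..?n}" for i
      using gaussian_pairs_law[OF gp] that by auto
    show "emeasure (gaussian_pair_law \<rho>) {w\<in>space borel. fst w = x} = 0" for x
      using emeasure_gaussian_pair_law_fst[of "{x}" \<rho>]
      by (auto simp: emeasure_density nn_integral_0_iff_AE AE_lborel_singleton
          split: split_indicator intro!: eventually_mono[OF AE_lborel_singleton[of x]])
    show "max_index X k \<in> measurable M (count_space {1..?n})"
      by (intro measurable_max_index X)
    show "fst (X i \<omega>, Y i \<omega>) \<le> fst (X (max_index X k \<omega>) \<omega>, Y (max_index X k \<omega>) \<omega>)"
      if "i \<in> {1..?n}" for i \<omega>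
      using is_arg_max_max_index[of X \<omega> k] that by (auto simp: is_arg_max_linorder)
  qed auto
  also have "\<dots> = (\<integral>\<^sup>+w. c (fst w) * indicator A w \<partial>gaussian_pair_law \<rho>)"
    using emeasure_gaussian_pair_law_fst[of "{..x}" \<rho> for x]
    by (intro nn_integral_cong)
      (simp add: c_def std_normal.emeasure_eq_measure cdf_def ennreal_mult ennreal_power ennreal_of_nat_eq_real_of_nat)
  also have "\<dots> = (\<integral>\<^sup>+p. c (fst p) * indicator A (gaussian_map \<rho> p) \<partial>(?N \<Otimes>\<^sub>M ?N))"
    unfolding gaussian_pair_law_def
    by (subst nn_integral_distr) (auto simp: gaussian_map_def[of _ p for p] intro!: nn_integral_cong)
  also have "\<dots> = (\<integral>\<^sup>+x. \<integral>\<^sup>+z. c x * indicator A (gaussian_map \<rho> (x, z)) \<partial>?N \<partial>?N)"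
    by (subst std_normal.nn_integral_fst[symmetric]) auto
  also have "\<dots> = (\<integral>\<^sup>+x. c x * emeasure ?N (Pair x -` (gaussian_map \<rho> -` A)) \<partial>?N)"
  proof (intro nn_integral_cong)
    fix x
    have [measurable]: "Pair x -` (gaussian_map \<rho> -` A) \<in> sets borel"
      using measurable_sets[of "\<lambda>z. gaussian_map \<rho> (x, z)" borel borel A] A
      by (simp add: vimage_def)
    have "(\<integral>\<^sup>+z. c x * indicator A (gaussian_map \<rho> (x, z)) \<partial>?N) =
        (\<integral>\<^sup>+z. c x * indicator (Pair x -` (gaussian_map \<rho> -` A)) z \<partial>?N)"
      by (intro nn_integral_cong) (auto split: split_indicator)
    then show "(\<integral>\<^sup>+z. c x * indicator A (gaussian_map \<rho> (x, z)) \<partial>?N) =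
        c x * emeasure ?N (Pair x -` (gaussian_map \<rho> -` A))"
      by (simp add: nn_integral_cmult_indicator)
  qed
  also have "\<dots> = (\<integral>\<^sup>+x. emeasure ?N (Pair x -` (gaussian_map \<rho> -` A)) \<partial>normal_max ?n)"
  proof -
    have "gaussian_map \<rho> -` A \<inter> space (borel \<Otimes>\<^sub>M ?N) \<in> sets (borel \<Otimes>\<^sub>M ?N)"
      by (rule measurable_sets[OF _ A]) simp
    then have "gaussian_map \<rho> -` A \<in> sets (borel \<Otimes>\<^sub>M ?N)"
      by (simp add: space_pair_measure)
    then have [measurable]: "(\<lambda>x. emeasure ?N (Pair x -` (gaussian_map \<rho> -` A))) \<in> borel_measurable borel"
      by (rule std_normal.measurable_emeasure_Pair)
    moreover have "ennreal (normal_max_density ?n x) = ennreal (std_normal_density x) * c x" for x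
      unfolding c_def normal_max_density_def
      by (subst ennreal_mult'[symmetric]) (auto simp: mult_ac)
    ultimately show ?thesis
      unfolding normal_max_def by (simp add: nn_integral_density mult.assoc)
  qed
  also have "\<dots> = emeasure (normal_max ?n \<Otimes>\<^sub>M ?N) (gaussian_map \<rho> -` A)"
  proof -
    have "gaussian_map \<rho> -` A \<inter> space (normal_max ?n \<Otimes>\<^sub>M ?N) \<in> sets (normal_max ?n \<Otimes>\<^sub>M ?N)"
      by (rule measurable_sets[OF _ A]) simp
    then show ?thesis
      by (intro std_normal.emeasure_pair_measure_alt[symmetric]) (simp add: space_pair_measure)
  qed
  also have "\<dots> = emeasure (distr (normal_max ?n \<Otimes>\<^sub>M ?N) borel (gaussian_map \<rho>)) A"
    by (subst emeasure_distr) (auto simp: space_pair_measure)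
  finally show "emeasure (distr M borel (max_statistic X Y k)) A =
      emeasure (distr (normal_max ?n \<Otimes>\<^sub>M ?N) borel (gaussian_map \<rho>)) A" .
qed simp

section \<open>Moments of the estimator\<close>

lemma integrable_pair_mult:
  fixes f :: "'a \<Rightarrow> real" and g :: "'b \<Rightarrow> real"
  assumes "sigma_finite_measure M1" "sigma_finite_measure M2"
    and f: "integrable M1 f" and g: "integrable M2 g"
  shows "integrable (M1 \<Otimes>\<^sub>M M2) (\<lambda>p. f (fst p) * g (snd p))"
    and "(LINT p|(M1 \<Otimes>\<^sub>M M2). f (fst p) * g (snd p)) = (LINT x|M1. f x) * (LINT y|M2. g y)"
proof -
  interpret M1: sigma_finite_measure M1 by fact
  interpret M2: sigma_finite_measure M2 by fact
  interpret pair_sigma_finite M1 M2 ..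
  have [measurable]: "f \<in> borel_measurable M1" "g \<in> borel_measurable M2"
    using f g by (auto dest: borel_measurable_integrable)
  show int: "integrable (M1 \<Otimes>\<^sub>M M2) (\<lambda>p. f (fst p) * g (snd p))"
    using f g by (intro Fubini_integrable) (auto simp: abs_mult)
  show "(LINT p|(M1 \<Otimes>\<^sub>M M2). f (fst p) * g (snd p)) = (LINT x|M1. f x) * (LINT y|M2. g y)"
    using integral_fst'[OF int] by simp
qed

definition max_pair_measure :: "nat \<Rightarrow> (real \<times> real) measure" where
  "max_pair_measure n = normal_max n \<Otimes>\<^sub>M std_normal_distribution"

lemma sets_max_pair_measure[simp, measurable_cong]:
  "sets (max_pair_measure n) = sets (borel \<Otimes>\<^sub>M borel)"
  unfolding max_pair_measure_def by (intro sets_pair_measure_cong) auto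

lemma max_pair_measure_mult:
  fixes f :: "real \<Rightarrow> real"
  assumes "0 < n" "integrable (normal_max n) f"
  shows integrable_max_pair_measure_mult: "integrable (max_pair_measure n) (\<lambda>p. f (fst p) * snd p ^ j)"
    and integral_max_pair_measure_mult: "(LINT p|max_pair_measure n. f (fst p) * snd p ^ j) =
      (LINT x|normal_max n. f x) * (LINT z|std_normal_distribution. z ^ j)"
  using integrable_pair_mult[OF _ _ assms(2) integrable_std_normal_distribution_moment[of j]]
    prob_space_normal_max[OF assms(1)] std_normal.sigma_finite_measure_axioms
  by (auto simp: max_pair_measure_def prob_space_imp_sigma_finite)

lemma integral_max_statistic:
  fixes h :: "real \<times> real \<Rightarrow> real"
  assumes gp: "gaussian_pairs M \<rho> X Y" and [measurable]: "h \<in> borel_measurable borel"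
  shows "integrable M (\<lambda>\<omega>. h (max_statistic X Y k \<omega>)) \<longleftrightarrow>
      integrable (max_pair_measure (2 ^ k)) (\<lambda>p. h (gaussian_map \<rho> p))"
    and "(LINT \<omega>|M. h (max_statistic X Y k \<omega>)) =
      (LINT p|max_pair_measure (2 ^ k). h (gaussian_map \<rho> p))"
proof -
  have [measurable]: "max_statistic X Y k \<in> borel_measurable M"
    using gp by (rule measurable_max_statistic)
  have eq: "distr M borel (max_statistic X Y k) = distr (max_pair_measure (2 ^ k)) borel (gaussian_map \<rho>)"
    unfolding max_pair_measure_def using gp by (rule distr_max_statistic)
  show "integrable M (\<lambda>\<omega>. h (max_statistic X Y k \<omega>)) \<longleftrightarrow>
      integrable (max_pair_measure (2 ^ k)) (\<lambda>p. h (gaussian_map \<rho> p))"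
    using arg_cong[OF eq, of "\<lambda>N. integrable N h"] by (simp add: integrable_distr_eq)
  show "(LINT \<omega>|M. h (max_statistic X Y k \<omega>)) =
      (LINT p|max_pair_measure (2 ^ k). h (gaussian_map \<rho> p))"
    using arg_cong[OF eq, of "\<lambda>N. integral\<^sup>L N h"] by (simp add: integral_distr)
qed

lemma std_normal_moments:
  "(LINT z|std_normal_distribution. z) = 0" "(LINT z|std_normal_distribution. z ^ 2) = 1"
  "(LINT z|std_normal_distribution. z ^ 3) = 0" "(LINT z|std_normal_distribution. z ^ 4) = 3"
  using integral_std_normal_distribution_moment_odd[of 1] integral_std_normal_distribution_moment_odd[of 3]
    std_normal_distribution_even_moments(1)[of 1] std_normal_distribution_even_moments(1)[of 2]
  by (auto simp: fact_numeral)

lemma rho_max_eq: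
  assumes gp: "gaussian_pairs M \<rho> X Y"
  shows "rho_max M X Y k = (\<lambda>\<omega>. snd (max_statistic X Y k \<omega>) / normal_max_mean (2 ^ k))"
proof -
  have "(LINT \<omega>|M. X (max_index X k \<omega>) \<omega>) = (LINT \<omega>|M. fst (max_statistic X Y k \<omega>))"
    by (simp add: max_statistic_def)
  \<comment> \<open>The factor \<open>snd p ^ 0\<close> brings the integrand into the product form
    of \<open>integral_max_pair_measure_mult\<close>.\<close>
  also have "\<dots> = (LINT p|max_pair_measure (2 ^ k). fst p * snd p ^ 0)"
    by (subst integral_max_statistic(2)[OF gp]) (auto simp: gaussian_map_def)
  also have "\<dots> = normal_max_mean (2 ^ k)"
    using integrable_normal_max_power[of "2 ^ k" 1] std_normal.prob_space
    by (subst integral_max_pair_measure_mult) (auto simp: normal_max_mean_def)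
  finally show ?thesis
    by (simp add: rho_max_def max_statistic_def fun_eq_iff)
qed

text \<open>In the independent coordinates the estimator is the linear form
  \<open>\<rho> / m * x + s / m * z\<close>, and the cross term drops out because \<open>z\<close>
  is centred. \<open>1 \<le> k\<close> ensures \<open>m > 0\<close>.\<close>

lemma rho_max_moments:
  assumes gp: "gaussian_pairs M \<rho> X Y" and \<rho>: "\<bar>\<rho>\<bar> \<le> 1" and k: "1 \<le> k"
  shows "integrable M (rho_max M X Y k)" "prob_space.expectation M (rho_max M X Y k) = \<rho>"
    "integrable M (\<lambda>\<omega>. (rho_max M X Y k \<omega>)\<^sup>2)"
    "prob_space.variance M (rho_max M X Y k) =
      (\<rho>\<^sup>2 * normal_max_variance (2 ^ k) + (1 - \<rho>\<^sup>2)) / (normal_max_mean (2 ^ k))\<^sup>2"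
proof -
  define n where "n = (2 ^ k :: nat)"
  define m where "m = normal_max_mean n"
  define s where "s = sqrt (1 - \<rho>\<^sup>2)"
  have "2 ^ 1 \<le> n"
    unfolding n_def using k by (intro power_increasing) auto
  then have n: "2 \<le> n" by simp
  then have m: "0 < m"
    unfolding m_def by (rule normal_max_mean_pos)
  have s: "s\<^sup>2 = 1 - \<rho>\<^sup>2"
    using \<rho> by (simp add: s_def abs_square_le_1)
  interpret Q: prob_space "normal_max n"
    using n by (intro prob_space_normal_max) auto
  note rho = rho_max_eq[OF gp, of k, folded n_def m_def]
  note law = integral_max_statistic[OF gp, of _ k, folded n_def]
  have x: "integrable (normal_max n) (\<lambda>x. x - c)" "integrable (normal_max n) (\<lambda>x. (x - c)\<^sup>2)" for c
    using integrable_normal_max_power[of n 1] integrable_normal_max_power[of n 2]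
    by (auto simp: power2_diff)
  have one: "integrable (normal_max n) (\<lambda>x. 1 :: real)" "(LINT x|normal_max n. 1 :: real) = 1"
    by (auto simp: Q.prob_space[simplified])
  note mult = integrable_max_pair_measure_mult[of n] integral_max_pair_measure_mult[of n]
  have i: "integrable (max_pair_measure n) (\<lambda>p. fst p - c)" "integrable (max_pair_measure n) (\<lambda>p. (fst p - c)\<^sup>2)"
      "integrable (max_pair_measure n) (\<lambda>p. (fst p - c) * snd p)" 
      "integrable (max_pair_measure n) snd" "integrable (max_pair_measure n) (\<lambda>p. (snd p)\<^sup>2)" for c
    using mult(1)[OF _ x(1)[of c], of 0] mult(1)[OF _ x(2)[of c], of 0] mult(1)[OF _ x(1)[of c], of 1]
      mult(1)[OF _ one(1), of 1] mult(1)[OF _ one(1), of 2] n by auto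
  have e: "(LINT p|max_pair_measure n. fst p) = m"
      "(LINT p|max_pair_measure n. (fst p - m)\<^sup>2) = normal_max_variance n"
      "(LINT p|max_pair_measure n. (fst p - m) * snd p) = 0"
      "(LINT p|max_pair_measure n. snd p) = 0" "(LINT p|max_pair_measure n. (snd p)\<^sup>2) = 1"
    using mult(2)[OF _ x(1)[of 0], of 0] mult(2)[OF _ x(2)[of m], of 0] mult(2)[OF _ x(1)[of m], of 1]
      mult(2)[OF _ one(1), of 1] mult(2)[OF _ one(1), of 2] n std_normal.prob_space
    by (auto simp: std_normal_moments Q.prob_space[simplified] m_def normal_max_mean_def normal_max_variance_def)
  have lin: "snd (gaussian_map \<rho> p) / m = \<rho> / m * fst p + s / m * snd p" for p
    by (simp add: gaussian_map_def s_def add_divide_distrib)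
  \<comment> \<open>Expanded about a free centre to serve both moments: \<open>c = d = 0\<close>
    gives the raw square, \<open>c = m\<close> and \<open>d = \<rho>\<close> the variance.\<close>
  have sq: "(snd (gaussian_map \<rho> p) / m - d)\<^sup>2 =
      \<rho>\<^sup>2 / m\<^sup>2 * (fst p - c)\<^sup>2 + 2 * \<rho> * s / m\<^sup>2 * ((fst p - c) * snd p) + s\<^sup>2 / m\<^sup>2 * (snd p)\<^sup>2"
    if "d = \<rho> * c / m" for p c d
    unfolding lin that using m by (simp add: field_simps power2_eq_square)
  show 1: "integrable M (rho_max M X Y k)"
    unfolding rho using i(1)[of 0] i(4) by (subst law(1)) (auto simp: lin)
  show 2: "prob_space.expectation M (rho_max M X Y k) = \<rho>"
    unfolding rho using i(1)[of 0] i(4) e m by (subst law(2)) (auto simp: lin)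
  have "integrable M (\<lambda>\<omega>. (rho_max M X Y k \<omega> - 0)\<^sup>2)"
    unfolding rho using i(2)[of 0] i(3)[of 0] i(5) by (subst law(1)) (auto simp: sq[of 0 0, simplified])
  then show "integrable M (\<lambda>\<omega>. (rho_max M X Y k \<omega>)\<^sup>2)"
    by simp
  have "prob_space.variance M (rho_max M X Y k) = (LINT \<omega>|M. (rho_max M X Y k \<omega> - \<rho>)\<^sup>2)"
    by (simp add: 2)
  also have "\<dots> = \<rho>\<^sup>2 / m\<^sup>2 * normal_max_variance n + s\<^sup>2 / m\<^sup>2"
    unfolding rho using i(2)[of m] i(3)[of m] i(5) e m
    by (subst law(2)) (auto simp: sq[of \<rho> m])
  finally show "prob_space.variance M (rho_max M X Y k) =
      (\<rho>\<^sup>2 * normal_max_variance (2 ^ k) + (1 - \<rho>\<^sup>2)) / (normal_max_mean (2 ^ k))\<^sup>2"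
    by (simp add: s n_def m_def add_divide_distrib)
qed

section \<open>Fisher information\<close>

definition max_statistic_density :: "nat \<Rightarrow> real \<Rightarrow> real \<times> real \<Rightarrow> real" where
  "max_statistic_density n r t =
    normal_max_density n (fst t) * normal_density (r * fst t) (sqrt (1 - r\<^sup>2)) (snd t)"

lemma borel_measurable_max_statistic_density[measurable]:
  "max_statistic_density n r \<in> borel_measurable borel"
  unfolding max_statistic_density_def[abs_def] normal_density_def by measurable

lemma max_statistic_density_nonneg: "0 \<le> max_statistic_density n r t"
  by (simp add: max_statistic_density_def normal_density_nonneg)

text \<open>For fixed \<open>x\<close> substitute \<open>y = r * x + s * z\<close>, with Jacobian
  \<open>s\<close>. Nondegeneracy \<open>s > 0\<close> is where \<open>\<bar>r\<bar> < 1\<close>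
  enters.\<close>

lemma distr_max_pair_measure_eq_density:
  assumes r: "\<bar>r\<bar> < 1"
  shows "distr (max_pair_measure n) lborel (gaussian_map r) = density lborel (max_statistic_density n r)"
proof (rule measure_eqI)
  define s where "s = sqrt (1 - r\<^sup>2)"
  have s: "0 < s"
    using r by (simp add: s_def abs_square_less_1)
  fix A assume "A \<in> sets (distr (max_pair_measure n) lborel (gaussian_map r))"
  then have A[measurable]: "A \<in> sets borel"
    by simp
  have gA: "gaussian_map r -` A \<in> sets (borel \<Otimes>\<^sub>M borel)"
    using measurable_sets[OF borel_measurable_gaussian_map A, of r] by (simp add: space_pair_measure)
  have "emeasure (distr (max_pair_measure n) lborel (gaussian_map r)) A =
      emeasure (max_pair_measure n) (gaussian_map r -` A)"
    by (subst emeasure_distr) (auto simp: max_pair_measure_def space_pair_measure)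
  also have "\<dots> = (\<integral>\<^sup>+x. emeasure std_normal_distribution (Pair x -` (gaussian_map r -` A)) \<partial>normal_max n)"
    unfolding max_pair_measure_def using gA
    by (intro std_normal.emeasure_pair_measure_alt) (simp cong: sets_pair_measure_cong)
  also have "\<dots> = (\<integral>\<^sup>+x. ennreal (normal_max_density n x) *
      emeasure std_normal_distribution (Pair x -` (gaussian_map r -` A)) \<partial>lborel)"
  proof -
    have "gaussian_map r -` A \<in> sets (borel \<Otimes>\<^sub>M std_normal_distribution)"
      using gA by (simp cong: sets_pair_measure_cong)
    then have "(\<lambda>x. emeasure std_normal_distribution (Pair x -` (gaussian_map r -` A))) \<in> borel_measurable borel"
      by (rule std_normal.measurable_emeasure_Pair)
    then show ?thesis
      unfolding normal_max_def by (simp add: nn_integral_density)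
  qed
  also have "\<dots> = (\<integral>\<^sup>+x. \<integral>\<^sup>+y. ennreal (max_statistic_density n r (x, y)) * indicator A (x, y) \<partial>lborel \<partial>lborel)"
  proof (intro nn_integral_cong)
    fix x
    have sec: "Pair x -` (gaussian_map r -` A) \<in> sets borel"
      using sets_Pair1[OF gA] .
    have "emeasure std_normal_distribution (Pair x -` (gaussian_map r -` A)) =
        (\<integral>\<^sup>+z. ennreal (std_normal_density z) * indicator A (x, r * x + s * z) \<partial>lborel)"
      using sec by (subst emeasure_density)
        (auto simp: gaussian_map_def s_def intro!: nn_integral_cong split: split_indicator)
    also have "\<dots> = (\<integral>\<^sup>+z. ennreal s * (ennreal (normal_density (r * x) s (r * x + s * z)) * indicator A (x, r * x + s * z)) \<partial>lborel)"
    proof (intro nn_integral_cong)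
      fix z
      have "std_normal_density z = s * normal_density (r * x) s (r * x + s * z)"
        using s by (simp add: normal_density_def real_sqrt_mult power_mult_distrib)
      then show "ennreal (std_normal_density z) * indicator A (x, r * x + s * z) =
          ennreal s * (ennreal (normal_density (r * x) s (r * x + s * z)) * indicator A (x, r * x + s * z))"
        using s by (simp add: ennreal_mult' mult.assoc)
    qed
    also have "\<dots> = ennreal s * (\<integral>\<^sup>+z. ennreal (normal_density (r * x) s (r * x + s * z)) * indicator A (x, r * x + s * z) \<partial>lborel)"
      by (intro nn_integral_cmult) measurable
    also have "\<dots> = (\<integral>\<^sup>+y. ennreal (normal_density (r * x) s y) * indicator A (x, y) \<partial>lborel)"
      using s by (subst nn_integral_real_affine[of "\<lambda>y. ennreal (normal_density (r * x) s y) * indicator A (x, y)" s "r * x"]) auto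
    finally show "ennreal (normal_max_density n x) * emeasure std_normal_distribution (Pair x -` (gaussian_map r -` A)) =
        (\<integral>\<^sup>+y. ennreal (max_statistic_density n r (x, y)) * indicator A (x, y) \<partial>lborel)"
      by (simp add: nn_integral_cmult[symmetric] max_statistic_density_def s_def ennreal_mult' mult.assoc)
  qed
  also have "\<dots> = (\<integral>\<^sup>+t. ennreal (max_statistic_density n r t) * indicator A t \<partial>lborel)"
    unfolding lborel_prod[symmetric]
    by (subst lborel.nn_integral_fst[symmetric]) (auto simp: lborel_prod)
  also have "\<dots> = emeasure (density lborel (max_statistic_density n r)) A"
    by (subst emeasure_density) auto
  finally show "emeasure (distr (max_pair_measure n) lborel (gaussian_map r)) A =
      emeasure (density lborel (max_statistic_density n r)) A" .
qed simp

lemma distributed_max_statistic: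
  assumes gp: "gaussian_pairs M r X Y" and r: "\<bar>r\<bar> < 1"
  shows "distributed M lborel (max_statistic X Y k) (max_statistic_density (2 ^ k) r)"
proof -
  have "distr M lborel (max_statistic X Y k) = distr M borel (max_statistic X Y k)"
    by (intro distr_cong) auto
  also have "\<dots> = distr (max_pair_measure (2 ^ k)) borel (gaussian_map r)"
    unfolding max_pair_measure_def using gp by (rule distr_max_statistic)
  also have "\<dots> = distr (max_pair_measure (2 ^ k)) lborel (gaussian_map r)"
    by (intro distr_cong) auto
  finally show ?thesis
    using measurable_max_statistic[OF gp, of k]
    by (simp add: distributed_def distr_max_pair_measure_eq_density[OF r])
qed

text \<open>The \<open>r\<close>-derivative of the log-density. The marginal density of the maximum
  carries no \<open>r\<close>, hence no \<open>n\<close> appears.\<close>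

definition max_statistic_score :: "real \<Rightarrow> real \<times> real \<Rightarrow> real" where
  "max_statistic_score r t = r / (1 - r\<^sup>2) + fst t * (snd t - r * fst t) / (1 - r\<^sup>2)
     - r * (snd t - r * fst t)\<^sup>2 / (1 - r\<^sup>2)\<^sup>2"

definition max_statistic_log_density :: "nat \<Rightarrow> real \<Rightarrow> real \<times> real \<Rightarrow> real" where
  "max_statistic_log_density n r t = ln (normal_max_density n (fst t)) - ln (2 * pi) / 2 - ln (1 - r\<^sup>2) / 2
     - (snd t - r * fst t)\<^sup>2 / (2 * (1 - r\<^sup>2))"

lemma max_statistic_density_eq_exp:
  assumes "\<bar>r\<bar> < 1" "0 < n"
  shows "max_statistic_density n r t = exp (max_statistic_log_density n r t)"
proof -
  have r: "0 < 1 - r\<^sup>2"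
    using assms by (simp add: abs_square_less_1)
  have "sqrt (2 * pi * (1 - r\<^sup>2)) = exp (ln (2 * pi * (1 - r\<^sup>2)) / 2)"
    using r by (simp add: ln_sqrt[symmetric])
  then have sqrt: "1 / sqrt (2 * pi * (1 - r\<^sup>2)) = exp (- (ln (2 * pi * (1 - r\<^sup>2)) / 2))"
    by (simp add: exp_minus inverse_eq_divide)
  have "ln (2 * pi * (1 - r\<^sup>2)) = ln (2 * pi) + ln (1 - r\<^sup>2)"
    using r by (intro ln_mult_pos) auto
  then have "max_statistic_log_density n r t = ln (normal_max_density n (fst t)) +
      (- (ln (2 * pi * (1 - r\<^sup>2)) / 2) + - (snd t - r * fst t)\<^sup>2 / (2 * (1 - r\<^sup>2)))"
    by (simp add: max_statistic_log_density_def add_divide_distrib)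
  moreover have "(sqrt (1 - r\<^sup>2))\<^sup>2 = 1 - r\<^sup>2"
    using r by simp
  ultimately show ?thesis
    unfolding max_statistic_density_def normal_density_def
    using normal_max_density_pos[OF assms(2), of "fst t"]
    by (simp only: exp_add exp_ln sqrt)
qed

lemma max_statistic_log_density_deriv:
  assumes "\<bar>r\<bar> < 1"
  shows "((\<lambda>r. max_statistic_log_density n r t) has_real_derivative max_statistic_score r t) (at r)"
proof -
  have r: "0 < 1 - r\<^sup>2"
    using assms by (simp add: abs_square_less_1)
  then show ?thesis
    unfolding max_statistic_log_density_def max_statistic_score_def
    by (auto intro!: derivative_eq_intros simp: power2_eq_square) (simp add: divide_simps; algebra)
qed

lemma smooth_density_family_max_statistic:
  assumes "\<And>r. r \<in> {-1<..<1} \<Longrightarrow> gaussian_pairs (P r) r X Y"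
  shows "smooth_density_family {-1<..<1} P (max_statistic X Y k) (max_statistic_density (2 ^ k))"
  unfolding smooth_density_family_def
proof (intro conjI ballI allI)
  fix r :: real assume r: "r \<in> {-1<..<1}"
  then show "distributed (P r) lborel (max_statistic X Y k) (max_statistic_density (2 ^ k) r)"
    using assms[OF r] by (intro distributed_max_statistic) auto
next
  fix t
  show "(\<lambda>r. max_statistic_density (2 ^ k) r t) differentiable_on {-1<..<1}"
    unfolding differentiable_on_def
  proof
    fix r :: real assume r: "r \<in> {-1<..<1}"
    then have "((\<lambda>r. exp (max_statistic_log_density (2 ^ k) r t)) has_real_derivative
        exp (max_statistic_log_density (2 ^ k) r t) * max_statistic_score r t) (at r)"
      by (intro DERIV_chain2[OF DERIV_exp] max_statistic_log_density_deriv) auto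
    then have "(\<lambda>r. exp (max_statistic_log_density (2 ^ k) r t)) differentiable at r within {-1<..<1}"
      using real_differentiable_def differentiable_at_withinI by blast
    then show "(\<lambda>r. max_statistic_density (2 ^ k) r t) differentiable at r within {-1<..<1}"
      \<comment> \<open>The radius 1 is arbitrary, as the exponential form is valid on the whole
        parameter interval.\<close>
      by (rule differentiable_transform_within[OF _ zero_less_one r])
        (auto simp: max_statistic_density_eq_exp)
  qed
qed (simp add: max_statistic_density_nonneg)

lemma deriv_ln_max_statistic_density:
  assumes "\<bar>r\<bar> < 1" "0 < n"
  shows "deriv (\<lambda>r. ln (max_statistic_density n r t)) r = max_statistic_score r t"
proof -
  have "\<forall>\<^sub>F r in nhds r. r \<in> {-1<..<1}"
    using assms by (intro eventually_nhds_in_open) auto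
  then have "\<forall>\<^sub>F r in nhds r. ln (max_statistic_density n r t) = max_statistic_log_density n r t"
    by eventually_elim (use assms in \<open>auto simp: max_statistic_density_eq_exp\<close>)
  then have "deriv (\<lambda>r. ln (max_statistic_density n r t)) r = deriv (\<lambda>r. max_statistic_log_density n r t) r"
    by (intro deriv_cong_ev refl)
  also have "\<dots> = max_statistic_score r t"
    using max_statistic_log_density_deriv[OF assms(1)] by (rule DERIV_imp_deriv)
  finally show ?thesis .
qed

text \<open>The information of a normal law with mean \<open>r * x\<close> and variance
  \<open>1 - r^2\<close>, averaged over \<open>x\<close>: the variance contributes the first
  summand, the mean contributes \<open>x^2 / (1 - r^2)\<close>, and \<open>v + m^2\<close> is the
  second moment of the maximum.\<close>

definition max_fisher_information :: "nat \<Rightarrow> real \<Rightarrow> real" where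
  "max_fisher_information n r = 2 * r\<^sup>2 / (1 - r\<^sup>2)\<^sup>2 +
     (normal_max_variance n + (normal_max_mean n)\<^sup>2) / (1 - r\<^sup>2)"

text \<open>After \<open>gaussian_map\<close> the residual \<open>y - r * x\<close> is
  \<open>s * z\<close>, so the score becomes \<open>r / s^2 * (1 - z^2) + x * z / s\<close>, a
  polynomial in independent variables.\<close>

lemma max_statistic_score_moment:
  assumes "\<bar>r\<bar> < 1" "2 \<le> n"
  shows "integrable (max_pair_measure n) (\<lambda>p. (max_statistic_score r (gaussian_map r p))\<^sup>2)"
    and "(LINT p|max_pair_measure n. (max_statistic_score r (gaussian_map r p))\<^sup>2) = max_fisher_information n r"
proof -
  define s where "s = sqrt (1 - r\<^sup>2)"
  have s: "0 < s" "1 - r\<^sup>2 = s\<^sup>2"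
    using assms by (auto simp: s_def abs_square_less_1 abs_square_le_1)
  interpret Q: prob_space "normal_max n"
    using assms by (intro prob_space_normal_max) auto
  note mult = integrable_max_pair_measure_mult[of n, OF _ integrable_normal_max_power]
     integral_max_pair_measure_mult[of n, OF _ integrable_normal_max_power]
  have i: "integrable (max_pair_measure n) (\<lambda>p. fst p ^ i * snd p ^ j)" for i j
    using mult(1)[of i j] assms by simp
  have sec: "(LINT x|normal_max n. x\<^sup>2) = normal_max_variance n + (normal_max_mean n)\<^sup>2"
    using normal_max_second_moment_about[OF assms(2), of 0] by (simp add: normal_max_variance_def)
  have e: "(LINT p|max_pair_measure n. fst p ^ i * snd p ^ j) =
      (LINT x|normal_max n. x ^ i) * (LINT z|std_normal_distribution. z ^ j)" for i j
    using mult(2)[of i j] assms by simp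
  define u where "u = 1 / s"
  have u: "u ^ 4 = 1 / (s\<^sup>2)\<^sup>2" "u\<^sup>2 = 1 / s\<^sup>2"
    by (simp_all add: u_def power_divide power_mult[symmetric])
  \<comment> \<open>Zeroth and first powers stay explicit so that every monomial matches
    \<open>i\<close> and \<open>e\<close>.\<close>
  define F where "F p = r\<^sup>2 * u^4 * (fst p ^ 0 * snd p ^ 0) - 2 * r\<^sup>2 * u^4 * (fst p ^ 0 * snd p ^ 2)
      + r\<^sup>2 * u^4 * (fst p ^ 0 * snd p ^ 4) + 2 * r * u^3 * (fst p ^ 1 * snd p ^ 1)
      - 2 * r * u^3 * (fst p ^ 1 * snd p ^ 3) + u\<^sup>2 * (fst p ^ 2 * snd p ^ 2)" for p :: "real \<times> real"
  have F: "(max_statistic_score r (gaussian_map r p))\<^sup>2 = F p" for p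
  proof -
    have "max_statistic_score r (gaussian_map r p) = r * u\<^sup>2 + fst p * snd p * u - r * (snd p)\<^sup>2 * u\<^sup>2"
      using s(1) unfolding max_statistic_score_def gaussian_map_def s(2) u_def
      by (simp add: s_def[symmetric] field_simps power2_eq_square)
    then show ?thesis
      unfolding F_def
      by (simp only: power2_eq_square power3_eq_cube power4_eq_xxxx power_0 power_one_right)
        (simp add: algebra_simps)
  qed
  show "integrable (max_pair_measure n) (\<lambda>p. (max_statistic_score r (gaussian_map r p))\<^sup>2)"
    unfolding F F_def
    by (intro Bochner_Integration.integrable_add Bochner_Integration.integrable_diff integrable_mult_right i)
  \<comment> \<open>The terms in \<open>x * z\<close> and \<open>x * z^3\<close> vanish by the odd
    moments of \<open>z\<close>; the coefficients 1, -2, 3 come from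
    \<open>1 - 2 * z^2 + z^4\<close> with second moment 1 and fourth moment 3.\<close>
  have "(LINT p|max_pair_measure n. F p) =
      r\<^sup>2 * u^4 - 2 * r\<^sup>2 * u^4 + 3 * r\<^sup>2 * u^4 + u\<^sup>2 * (normal_max_variance n + (normal_max_mean n)\<^sup>2)"
    unfolding F_def
    by (simp only: Bochner_Integration.integral_add Bochner_Integration.integral_diff integral_mult_right_zero
        Bochner_Integration.integrable_add Bochner_Integration.integrable_diff integrable_mult_right i e)
      (simp add: std_normal_moments Q.prob_space[simplified] std_normal.prob_space[simplified] sec)
  then show "(LINT p|max_pair_measure n. (max_statistic_score r (gaussian_map r p))\<^sup>2) = max_fisher_information n r"
    unfolding F max_fisher_information_def s(2) u by simp
qed

lemma has_fisher_information_max_statistic: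
  assumes gp: "\<And>r. r \<in> {-1<..<1} \<Longrightarrow> gaussian_pairs (P r) r X Y" and \<rho>: "\<bar>\<rho>\<bar> < 1" and k: "1 \<le> k"
  shows "has_fisher_information {-1<..<1} P (max_statistic X Y k) \<rho> (max_fisher_information (2 ^ k) \<rho>)"
  unfolding has_fisher_information_def
proof (intro exI conjI)
  show "smooth_density_family {-1<..<1} P (max_statistic X Y k) (max_statistic_density (2 ^ k))"
    by (intro smooth_density_family_max_statistic gp)
  have "(2::nat) ^ 1 \<le> 2 ^ k"
    using k by (intro power_increasing) auto
  then have n: "(2::nat) \<le> 2 ^ k" by simp
  have [measurable]: "(\<lambda>t. (max_statistic_score \<rho> t)\<^sup>2) \<in> borel_measurable borel"
    unfolding max_statistic_score_def by measurable
  have gp\<rho>: "gaussian_pairs (P \<rho>) \<rho> X Y"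
    using gp[of \<rho>] \<rho> by (simp add: abs_less_iff)
  have deriv: "deriv (\<lambda>r. ln (max_statistic_density (2 ^ k) r t)) \<rho> = max_statistic_score \<rho> t" for t
    using \<rho> by (intro deriv_ln_max_statistic_density) auto
  show "integrable (P \<rho>) (\<lambda>\<omega>. (deriv (\<lambda>r. ln (max_statistic_density (2 ^ k) r (max_statistic X Y k \<omega>))) \<rho>)\<^sup>2)"
    unfolding deriv using max_statistic_score_moment(1)[OF \<rho> n]
    by (subst integral_max_statistic(1)[OF gp\<rho>]) auto
  show "max_fisher_information (2 ^ k) \<rho> = prob_space.expectation (P \<rho>)
      (\<lambda>\<omega>. (deriv (\<lambda>r. ln (max_statistic_density (2 ^ k) r (max_statistic X Y k \<omega>))) \<rho>)\<^sup>2)"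
    unfolding deriv using max_statistic_score_moment(2)[OF \<rho> n]
    by (subst integral_max_statistic(2)[OF gp\<rho>]) auto
qed

section \<open>Asymptotics\<close>

lemma filterlim_power2_at_top: "filterlim (\<lambda>k. 2 ^ k :: nat) at_top sequentially"
  by (rule filterlim_subseq) (auto simp: strict_mono_def)

text \<open>With \<open>n = 2 ^ k\<close> one has \<open>a = sqrt (2 * ln 2) * sqrt k\<close>: the
  \<open>ln 2\<close> in the variance converts bits into natural logarithms. Dividing by
  \<open>sqrt k\<close> makes the error \<open>m - a\<close> harmless.\<close>

lemma normal_max_mean_asymp:
  "(\<lambda>k. real k / (normal_max_mean (2 ^ k))\<^sup>2) \<longlonglongrightarrow> 1 / (2 * ln 2)"
proof -
  define d where "d k = normal_max_mean (2 ^ k) - sqrt (2 * ln (real (2 ^ k)))" for k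
  have "d \<longlonglongrightarrow> 0"
    unfolding d_def
    using filterlim_compose[OF normal_max_mean_tendsto filterlim_power2_at_top] by simp
  moreover have "(\<lambda>k. 1 / sqrt (real k)) \<longlonglongrightarrow> 0"
    by real_asymp
  ultimately have "(\<lambda>k. 1 / (sqrt (2 * ln 2) + d k * (1 / sqrt (real k)))\<^sup>2) \<longlonglongrightarrow>
      1 / (sqrt (2 * ln 2) + 0 * 0)\<^sup>2"
    by (intro tendsto_intros) auto
  also have "1 / (sqrt (2 * ln 2) + 0 * 0)\<^sup>2 = 1 / (2 * ln (2 :: real))"
    by simp
  finally show ?thesis
  proof (rule Lim_transform_eventually)
    show "\<forall>\<^sub>F k in sequentially. 1 / (sqrt (2 * ln 2) + d k * (1 / sqrt (real k)))\<^sup>2 =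
        real k / (normal_max_mean (2 ^ k))\<^sup>2"
      using eventually_gt_at_top[of 0]
    proof eventually_elim
      case (elim k)
      have "sqrt (2 * ln (real (2 ^ k))) = sqrt (2 * ln 2) * sqrt (real k)"
        by (simp add: ln_realpow real_sqrt_mult[symmetric] mult_ac)
      then have "sqrt (2 * ln 2) + d k * (1 / sqrt (real k)) = normal_max_mean (2 ^ k) / sqrt (real k)"
        using elim by (simp add: d_def field_simps)
      then show ?case
        using elim by (simp add: power_divide)
    qed
  qed
qed

text \<open>The family \<open>P\<close> enters through the Fisher information, which compares laws
  at neighbouring parameters. The denominator of the estimator is written with
  \<open>P \<rho>\<close>, but by \<open>rho_max_eq\<close> it equals
  \<open>normal_max_mean (2 ^ k)\<close> and so does not depend on the unknown correlation.\<close>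

theorem theorem1:
  fixes P :: "real \<Rightarrow> 'w measure"
    and X Y :: "nat \<Rightarrow> 'w \<Rightarrow> real"
    and \<rho> :: real
  assumes "\<rho> \<in> {-1..1}"
    and "gaussian_pairs (P \<rho>) \<rho> X Y"
  shows "(\<forall>k\<ge>1. integrable (P \<rho>) (rho_max (P \<rho>) X Y k) \<and>
                 prob_space.expectation (P \<rho>) (rho_max (P \<rho>) X Y k) = \<rho>) \<and>
         (\<forall>k\<ge>1. integrable (P \<rho>) (\<lambda>\<omega>. (rho_max (P \<rho>) X Y k \<omega>)\<^sup>2)) \<and>
         (\<exists>\<epsilon> :: nat \<Rightarrow> real. \<epsilon> \<longlonglongrightarrow> 0 \<and>
            (\<forall>k\<ge>1. prob_space.variance (P \<rho>) (rho_max (P \<rho>) X Y k) =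
                   1 / real k * ((1 - \<rho>\<^sup>2) / (2 * ln 2) + \<epsilon> k))) \<and>
         (\<bar>\<rho>\<bar> < 1 \<longrightarrow> (\<forall>r\<in>{-1<..<1}. gaussian_pairs (P r) r X Y) \<longrightarrow>
            asymptotically_efficient {-1<..<1} P (max_statistic X Y) (rho_max (P \<rho>) X Y) \<rho>)"
proof -
  define m where "m k = normal_max_mean (2 ^ k)" for k
  define v where "v k = normal_max_variance (2 ^ k)" for k
  define V where "V k = prob_space.variance (P \<rho>) (rho_max (P \<rho>) X Y k)" for k
  have \<rho>: "\<bar>\<rho>\<bar> \<le> 1"
    using assms(1) by auto
  note moments = rho_max_moments[OF assms(2) \<rho>]
  have V: "V k = (\<rho>\<^sup>2 * v k + (1 - \<rho>\<^sup>2)) / (m k)\<^sup>2" if "1 \<le> k" for k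
    unfolding V_def v_def m_def using that by (rule moments(4))
  have v: "v \<longlonglongrightarrow> 0"
    unfolding v_def using filterlim_compose[OF normal_max_variance_tendsto filterlim_power2_at_top] .
  have m: "(\<lambda>k. real k / (m k)\<^sup>2) \<longlonglongrightarrow> 1 / (2 * ln 2)"
    unfolding m_def by (rule normal_max_mean_asymp)
  define \<epsilon> where "\<epsilon> k = real k * V k - (1 - \<rho>\<^sup>2) / (2 * ln 2)" for k
  have "(\<lambda>k. (\<rho>\<^sup>2 * v k + (1 - \<rho>\<^sup>2)) * (real k / (m k)\<^sup>2) - (1 - \<rho>\<^sup>2) / (2 * ln 2)) \<longlonglongrightarrow>
      (\<rho>\<^sup>2 * 0 + (1 - \<rho>\<^sup>2)) * (1 / (2 * ln 2)) - (1 - \<rho>\<^sup>2) / (2 * ln 2)"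
    by (intro tendsto_intros v m)
  then have "(\<lambda>k. (\<rho>\<^sup>2 * v k + (1 - \<rho>\<^sup>2)) * (real k / (m k)\<^sup>2) - (1 - \<rho>\<^sup>2) / (2 * ln 2)) \<longlonglongrightarrow> 0"
    by simp
  then have \<epsilon>: "\<epsilon> \<longlonglongrightarrow> 0"
  proof (rule Lim_transform_eventually)
    show "\<forall>\<^sub>F k in sequentially. (\<rho>\<^sup>2 * v k + (1 - \<rho>\<^sup>2)) * (real k / (m k)\<^sup>2) - (1 - \<rho>\<^sup>2) / (2 * ln 2) = \<epsilon> k"
      using eventually_ge_at_top[of 1] by eventually_elim (simp add: \<epsilon>_def V)
  qed
  have variance: "V k = 1 / real k * ((1 - \<rho>\<^sup>2) / (2 * ln 2) + \<epsilon> k)" if "1 \<le> k" for k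
    using that by (simp add: \<epsilon>_def)
  have efficient: "asymptotically_efficient {-1<..<1} P (max_statistic X Y) (rho_max (P \<rho>) X Y) \<rho>"
    if \<rho>': "\<bar>\<rho>\<bar> < 1" and gp: "\<forall>r\<in>{-1<..<1}. gaussian_pairs (P r) r X Y"
    unfolding asymptotically_efficient_def
  proof (intro conjI exI allI impI)
    show "(\<lambda>k. prob_space.expectation (P \<rho>) (rho_max (P \<rho>) X Y k)) \<longlonglongrightarrow> \<rho>"
      by (intro tendsto_eventually eventually_mono[OF eventually_ge_at_top[of 1]] moments(2))
    show "has_fisher_information {-1<..<1} P (max_statistic X Y k) \<rho> (max_fisher_information (2 ^ k) \<rho>)"
      if "1 \<le> k" for k
      using gp \<rho>' that by (intro has_fisher_information_max_statistic) auto
    define t where "t = 1 - \<rho>\<^sup>2"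
    have t: "0 < t"
      using \<rho>' by (simp add: t_def abs_square_less_1)
    \<comment> \<open>Since \<open>k / m^2\<close> converges, multiplying by \<open>1 / k\<close>
      shows that \<open>1 / m^2\<close> vanishes.\<close>
    have "(\<lambda>k. 1 / real k) \<longlonglongrightarrow> 0"
      by real_asymp
    with m have "(\<lambda>k. real k / (m k)\<^sup>2 * (1 / real k)) \<longlonglongrightarrow> 1 / (2 * ln 2) * 0"
      by (rule tendsto_mult)
    then have "(\<lambda>k. real k / (m k)\<^sup>2 * (1 / real k)) \<longlonglongrightarrow> 0"
      by simp
    then have q: "(\<lambda>k. 1 / (m k)\<^sup>2) \<longlonglongrightarrow> 0"
      by (rule Lim_transform_eventually) (rule eventually_mono[OF eventually_ge_at_top[of 1]], simp)
    \<comment> \<open>The factor \<open>1 / m^2\<close> of the variance is moved into the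
      information: its bounded first summand then vanishes, the second tends to
      \<open>1 / t\<close>, and the numerator of the variance tends to \<open>t\<close>.\<close>
    have "(\<lambda>k. (2 * \<rho>\<^sup>2 / t\<^sup>2 * (1 / (m k)\<^sup>2) + (v k * (1 / (m k)\<^sup>2) + 1) / t) * (\<rho>\<^sup>2 * v k + t)) \<longlonglongrightarrow>
        (2 * \<rho>\<^sup>2 / t\<^sup>2 * 0 + (0 * 0 + 1) / t) * (\<rho>\<^sup>2 * 0 + t)"
      using t by (intro tendsto_intros v q) auto
    then have "(\<lambda>k. (2 * \<rho>\<^sup>2 / t\<^sup>2 * (1 / (m k)\<^sup>2) + (v k * (1 / (m k)\<^sup>2) + 1) / t) * (\<rho>\<^sup>2 * v k + t)) \<longlonglongrightarrow> 1"
      using t by simp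
    then have "(\<lambda>k. max_fisher_information (2 ^ k) \<rho> * V k) \<longlonglongrightarrow> 1"
    proof (rule Lim_transform_eventually)
      show "\<forall>\<^sub>F k in sequentially. (2 * \<rho>\<^sup>2 / t\<^sup>2 * (1 / (m k)\<^sup>2) + (v k * (1 / (m k)\<^sup>2) + 1) / t) * (\<rho>\<^sup>2 * v k + t) =
          max_fisher_information (2 ^ k) \<rho> * V k"
        using eventually_ge_at_top[of 1]
      proof eventually_elim
        case (elim k)
        have "(2::nat) ^ 1 \<le> 2 ^ k"
          using elim by (intro power_increasing) auto
        then have "0 < m k"
          unfolding m_def by (intro normal_max_mean_pos) simp
        then show ?case
          using t unfolding V[OF elim] max_fisher_information_def v_def[symmetric] m_def[symmetric] t_def[symmetric]
          by (simp add: divide_simps)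
      qed
    qed
    then show "(\<lambda>k. max_fisher_information (2 ^ k) \<rho> * prob_space.variance (P \<rho>) (rho_max (P \<rho>) X Y k)) \<longlonglongrightarrow> 1"
      by (simp add: V_def)
  qed
  show ?thesis
    using moments(1-3) \<epsilon> variance[unfolded V_def] efficient by blast
qed

end
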